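(* For every positive integer $k$ there is a constant $c_k$ depending only on $k$ such that, for every positive integer $n$, every $n$-vertex simple topological graph not containing a plane path of length $k$ has at most $c_k\, n^{2 - 8/k^4}$ edges.
   Context: A topological graph is a (finite) graph drawn in the plane such that its vertices are represented by points and its edges by non-self-intersecting arcs connecting the corresponding points. No edge passes through a point representing a vertex other than its endpoints. Tangencies between edges are not allowed: if two edges share an interior point, they properly cross at this point. A topological graph is simple if every pair of its edges intersect at most once: at a common endpoint or at a proper crossing. A path of length $k$ consists of $k+1$ distinct vertices and $k$ edges. A path in a topological graph is plane if no two of its edges cross. *)

theory Defs
  imports "HOL-Analysis.Analysis"
begin

text \<open>
  The plane is the type \<^typ>\<open>complex\<close>.  Vertices are identified with the points
  representing them; an edge is the two-element set of its endpoints, and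
  \<open>\<gamma> e\<close> is the arc that represents the edge \<open>e\<close>.  Loops are ruled out because
  an arc has distinct endpoints.  Parallel edges cannot be represented, which loses nothing
  for simple topological graphs: two parallel edges meet in both of their endpoints.
\<close>

definition arc_interior :: "(real \<Rightarrow> complex) \<Rightarrow> complex set" where
  "arc_interior g = path_image g - {pathstart g, pathfinish g}"

text \<open>
  Arcs are arbitrary Jordan arcs, without any smoothness, so a proper crossing (one arc passes
  from one side of the other arc to the other side) is expressed topologically: near the common
  interior point, the pair of arcs looks, up to a homeomorphism, like the real and the imaginary
  axis near the origin.
\<close>

definition properly_cross_at ::
    "(real \<Rightarrow> complex) \<Rightarrow> (real \<Rightarrow> complex) \<Rightarrow> complex \<Rightarrow> bool" where
  "properly_cross_at g h x \<longleftrightarrow>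
     x \<in> arc_interior g \<and> x \<in> arc_interior h \<and>
     (\<exists>U \<phi> \<psi>. open U \<and> x \<in> U \<and> homeomorphism U (ball (0::complex) 1) \<phi> \<psi> \<and> \<phi> x = 0 \<and>
        \<phi> ` (U \<inter> path_image g) = {z \<in> ball 0 1. Im z = 0} \<and>
        \<phi> ` (U \<inter> path_image h) = {z \<in> ball 0 1. Re z = 0})"

definition arcs_cross :: "(real \<Rightarrow> complex) \<Rightarrow> (real \<Rightarrow> complex) \<Rightarrow> bool" where
  "arcs_cross g h \<longleftrightarrow> (\<exists>x. properly_cross_at g h x)"

definition topological_graph ::
    "complex set \<Rightarrow> complex set set \<Rightarrow> (complex set \<Rightarrow> real \<Rightarrow> complex) \<Rightarrow> bool" where
  "topological_graph V E \<gamma> \<longleftrightarrow>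
     finite V \<and>
     (\<forall>e\<in>E. e \<subseteq> V \<and> card e = 2) \<and>
     (\<forall>e\<in>E. arc (\<gamma> e) \<and> {pathstart (\<gamma> e), pathfinish (\<gamma> e)} = e) \<and>
     (\<forall>e\<in>E. arc_interior (\<gamma> e) \<inter> V = {}) \<and>
     (\<forall>e\<in>E. \<forall>f\<in>E. e \<noteq> f \<longrightarrow>
        (\<forall>x \<in> arc_interior (\<gamma> e) \<inter> arc_interior (\<gamma> f). properly_cross_at (\<gamma> e) (\<gamma> f) x))"

text \<open>
  In a topological graph, every common point of two edges is a common endpoint or
  a proper crossing, so for simplicity it only remains to bound the number of common points.
\<close>

definition simple_topological_graph ::
    "complex set \<Rightarrow> complex set set \<Rightarrow> (complex set \<Rightarrow> real \<Rightarrow> complex) \<Rightarrow> bool" where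
  "simple_topological_graph V E \<gamma> \<longleftrightarrow>
     topological_graph V E \<gamma> \<and>
     (\<forall>e\<in>E. \<forall>f\<in>E. e \<noteq> f \<longrightarrow>
        (\<forall>x \<in> path_image (\<gamma> e) \<inter> path_image (\<gamma> f).
         \<forall>y \<in> path_image (\<gamma> e) \<inter> path_image (\<gamma> f). x = y))"

definition graph_path :: "complex set \<Rightarrow> complex set set \<Rightarrow> nat \<Rightarrow> complex list \<Rightarrow> bool" where
  "graph_path V E k vs \<longleftrightarrow>
     length vs = k + 1 \<and> distinct vs \<and> set vs \<subseteq> V \<and> (\<forall>i<k. {vs ! i, vs ! Suc i} \<in> E)"

definition plane_path ::
    "complex set \<Rightarrow> complex set set \<Rightarrow> (complex set \<Rightarrow> real \<Rightarrow> complex) \<Rightarrow> nat \<Rightarrow> complex list \<Rightarrow> bool"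
where
  "plane_path V E \<gamma> k vs \<longleftrightarrow>
     graph_path V E k vs \<and>
     (\<forall>i<k. \<forall>j<k. i \<noteq> j \<longrightarrow>
        \<not> arcs_cross (\<gamma> {vs ! i, vs ! Suc i}) (\<gamma> {vs ! j, vs ! Suc j}))"

end

theory Submission imports Defs "HOL-Library.Ramsey" begin

text \<open>
  A graph with more than \<open>c n^(2 - 1/k)\<close> edges, for a suitable constant \<open>c\<close>, contains a complete bipartite
  graph with \<open>k\<close> vertices \<open>a\<close> on one side and as many vertices \<open>b\<close> on the other side as desired, by the theorem of
  Kovari, Sos and Turan (\<open>kovari_sos_turan\<close>). For \<open>k \<ge> 2\<close> the exponent \<open>2 - 1/k\<close> is at most
  \<open>2 - 8/k^4\<close>, so it suffices to find a plane path of length \<open>k\<close> in such a subgraph; for \<open>k = 1\<close> every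
  edge is such a path.

  Fix two vertices \<open>b\<close> and \<open>b'\<close> of the large side and write \<open>p \<rightarrow> q\<close> if the edge from \<open>b\<close> to \<open>a p\<close>
  crosses the edge from \<open>b'\<close> to \<open>a q\<close>. The heart of the proof is that this relation is acyclic
  (\<open>acyclic_crossing\<close>). Every arrow \<open>p \<rightarrow> q\<close> yields a Jordan curve, formed by parts of the two
  crossing edges and the edge from \<open>b\<close> to \<open>a q\<close>, and parity arguments with this curve show that the
  relation is asymmetric (\<open>crossing_asym\<close>) and that every walk \<open>p \<rightarrow> q \<rightarrow> r \<rightarrow> u\<close> has one of the shortcuts
  \<open>p \<rightarrow> r\<close>, \<open>p \<rightarrow> u\<close>, \<open>q \<rightarrow> u\<close> (\<open>crossing_shortcut\<close>). A shortest directed cycle has no shortcuts, so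
  there is none. The parity arguments rest on two local facts about a proper crossing: an arc that
  crosses a Jordan curve once changes sides (\<open>single_crossing_separates\<close>), and where the curve turns
  from one of two crossing arcs into the other one, the two branches that it leaves are on the same
  side (\<open>crossing_opposite_branches_same_side\<close>).

  Hence each ordered pair \<open>b\<close>, \<open>b'\<close> admits an ordering of the small side in which no edge at \<open>b\<close>
  crosses an edge at \<open>b'\<close> with a later endpoint. By Ramsey's theorem there are \<open>k\<close> vertices
  of the large side for which the same ordering serves all pairs (\<open>plane_path_in_complete_bipartite\<close>).
  The zigzag path that runs monotonically through both sides is then plane (\<open>zigzag_plane_path\<close>).
\<close>

section \<open>Arcs and curves near a proper crossing\<close>

definition arc_cut ::
  "(real \<Rightarrow> complex) \<Rightarrow> complex \<Rightarrow> (real \<Rightarrow> complex) \<Rightarrow> (real \<Rightarrow> complex) \<Rightarrow> bool" where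
  "arc_cut g x g1 g2 \<longleftrightarrow> arc g1 \<and> arc g2 \<and>
     pathstart g1 = pathstart g \<and> pathfinish g1 = x \<and>
     pathstart g2 = x \<and> pathfinish g2 = pathfinish g \<and>
     path_image g1 \<union> path_image g2 = path_image g \<and>
     path_image g1 \<inter> path_image g2 = {x}"

lemma arc_cut_exists:
  assumes "arc g" "x \<in> arc_interior g"
  obtains g1 g2 where "arc_cut g x g1 g2"
proof -
  obtain u where u: "u \<in> {0..1}" "g u = x"
    using assms by (auto simp: arc_interior_def path_image_def)
  have u01: "u \<noteq> 0" "u \<noteq> 1"
    using assms u by (auto simp: arc_interior_def pathstart_def pathfinish_def)
  have inj: "inj_on g {0..1}" using assms(1) by (simp add: arc_def)
  have im1: "path_image (subpath 0 u g) = g ` {0..u}"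
    and im2: "path_image (subpath u 1 g) = g ` {u..1}"
    using u by (auto simp: path_image_subpath)
  have "{0..u} \<union> {u..1} = {0..1}" using u by auto
  then have un: "g ` {0..u} \<union> g ` {u..1} = path_image g"
    by (metis image_Un path_image_def)
  have "g ` {0..u} \<inter> g ` {u..1} = g ` ({0..u} \<inter> {u..1})"
    using u by (intro inj_on_image_Int[symmetric, OF inj]) auto
  also have "{0..u} \<inter> {u..1} = {u}" using u by auto
  finally have int: "g ` {0..u} \<inter> g ` {u..1} = {x}" using u by simp
  have "arc_cut g x (subpath 0 u g) (subpath u 1 g)"
    unfolding arc_cut_def im1 im2 un int pathstart_subpath pathfinish_subpath
    using arc_subpath_arc[OF assms(1), of 0 u] arc_subpath_arc[OF assms(1), of u 1] u u01
    by (simp add: pathstart_def pathfinish_def)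
  then show ?thesis using that by blast
qed

lemma arc_minus_finish:
  assumes "arc g"
  shows "connected (path_image g - {pathfinish g})"
    and "pathfinish g \<in> closure (path_image g - {pathfinish g})"
proof -
  have inj: "inj_on g {0..1}" and cont: "continuous_on {0..1} g"
    using assms by (auto simp: arc_def path_def)
  have eq: "path_image g - {pathfinish g} = g ` {0..<1}"
    using inj by (fastforce simp: path_image_def pathfinish_def inj_on_def image_iff)
  have c: "continuous_on {0..<1} g" by (rule continuous_on_subset[OF cont]) auto
  show "connected (path_image g - {pathfinish g})"
    unfolding eq by (intro connected_continuous_image c) auto
  have "g ` closure {0..<1} \<subseteq> closure (g ` {0..<1})"
    by (rule image_closure_subset) (simp_all add: cont closure_subset)
  then show "pathfinish g \<in> closure (path_image g - {pathfinish g})"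
    unfolding eq by (simp add: pathfinish_def image_subset_iff)
qed

lemma arc_minus_start:
  assumes "arc g"
  shows "connected (path_image g - {pathstart g})"
    and "pathstart g \<in> closure (path_image g - {pathstart g})"
  using arc_minus_finish[of "reversepath g"] assms by (auto simp: arc_reversepath)

text \<open>
  Precomposing a chart of the crossing with a contraction of the disc makes its image as small
  as desired. All local arguments below take place inside one such chart, in which the two arcs
  are the coordinate axes and every other obstacle is out of reach.
\<close>

lemma crossing_chart:
  assumes "properly_cross_at g h x" "open W" "x \<in> W"
  obtains \<psi> :: "complex \<Rightarrow> complex" where
    "continuous_on (ball 0 1) \<psi>" "inj_on \<psi> (ball 0 1)"
    "open (\<psi> ` ball 0 1)" "\<psi> ` ball 0 1 \<subseteq> W" "\<psi> 0 = x"
    "\<And>z. z \<in> ball 0 1 \<Longrightarrow> \<psi> z \<in> path_image g \<longleftrightarrow> Im z = 0"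
    "\<And>z. z \<in> ball 0 1 \<Longrightarrow> \<psi> z \<in> path_image h \<longleftrightarrow> Re z = 0"
proof -
  obtain U \<phi> \<psi> where U: "open U" "x \<in> U" and hom: "homeomorphism U (ball (0::complex) 1) \<phi> \<psi>"
    and x: "\<phi> x = 0"
    and g: "\<phi> ` (U \<inter> path_image g) = {z \<in> ball 0 1. Im z = 0}"
    and h: "\<phi> ` (U \<inter> path_image h) = {z \<in> ball 0 1. Re z = 0}"
    using assms(1) unfolding properly_cross_at_def by blast
  have psi: "continuous_on (ball 0 1) \<psi>" "\<psi> ` ball 0 1 = U" "\<And>z. z \<in> ball 0 1 \<Longrightarrow> \<phi> (\<psi> z) = z"
    and phi: "continuous_on U \<phi>" "\<And>y. y \<in> U \<Longrightarrow> \<psi> (\<phi> y) = y" "\<phi> ` U = ball 0 1"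
    using hom by (auto simp: homeomorphism_def)
  have psi0: "\<psi> 0 = x" using phi(2)[OF U(2)] x by simp
  have "open (ball 0 1 \<inter> \<psi> -` W)"
    using psi(1) assms(2) by (auto intro: continuous_open_preimage)
  moreover have "0 \<in> ball 0 1 \<inter> \<psi> -` W" using psi0 assms(3) by simp
  ultimately obtain r where r: "r > 0" "ball 0 r \<subseteq> ball 0 1 \<inter> \<psi> -` W"
    by (meson open_contains_ball)
  define k where "k z = \<psi> (of_real r * z)" for z
  have scale: "of_real r * z \<in> ball 0 r" if "z \<in> ball 0 1" for z :: complex
    using that r by (simp add: norm_mult)
  then have scale1: "of_real r * z \<in> ball 0 1" if "z \<in> ball 0 1" for z :: complex
    using that r by blast
  have im: "(\<lambda>z. of_real r * z) ` ball 0 1 = ball (0::complex) r"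
  proof
    show "(\<lambda>z. of_real r * z) ` ball 0 1 \<subseteq> ball (0::complex) r" using scale by blast
    have "z = of_real r * (z / of_real r) \<and> z / of_real r \<in> ball 0 1" if "z \<in> ball 0 r" for z :: complex
      using that r by (simp add: norm_divide)
    then show "ball (0::complex) r \<subseteq> (\<lambda>z. of_real r * z) ` ball 0 1" by blast
  qed
  have im2: "k ` ball 0 1 = \<psi> ` ball 0 r"
    unfolding k_def im[symmetric] by (simp add: image_image)
  have "\<psi> ` ball 0 r = U \<inter> \<phi> -` ball 0 r"
    using psi phi r by (force simp: image_iff)
  then have op: "open (k ` ball 0 1)"
    unfolding im2 using continuous_open_preimage[OF phi(1) U(1)] by auto
  have on_axis: "\<psi> z \<in> S \<longleftrightarrow> P z"
    if S: "\<phi> ` (U \<inter> S) = {z \<in> ball 0 1. P z}" and z: "z \<in> ball 0 1" for S P z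
  proof -
    have zU: "\<psi> z \<in> U" using psi(2) z by blast
    have "\<psi> z \<in> S" if "z \<in> \<phi> ` (U \<inter> S)" using that phi(2) by auto
    moreover have "z \<in> \<phi> ` (U \<inter> S)" if "\<psi> z \<in> S"
      using that zU psi(3)[OF z] by (intro image_eqI[of _ _ "\<psi> z"]) auto
    ultimately show ?thesis using S z by blast
  qed
  note psi_g = on_axis[OF g] and psi_h = on_axis[OF h]
  show ?thesis
  proof (rule that[of k])
    show "continuous_on (ball 0 1) k"
      unfolding k_def
      by (rule continuous_on_compose2[OF psi(1)]) (auto intro!: continuous_intros dest: scale1)
    show "inj_on k (ball 0 1)"
    proof (rule inj_onI)
      fix y z :: complex assume a: "y \<in> ball 0 1" "z \<in> ball 0 1" "k y = k z"
      then have "of_real r * y = of_real r * z"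
        unfolding k_def using psi(3) scale1 by metis
      then show "y = z" using r by simp
    qed
    show "open (k ` ball 0 1)" by (rule op)
    show "k ` ball 0 1 \<subseteq> W" unfolding im2 using r by auto
    show "k 0 = x" by (simp add: k_def psi0)
    show "k z \<in> path_image g \<longleftrightarrow> Im z = 0" if "z \<in> ball 0 1" for z
      unfolding k_def using psi_g[OF scale1[OF that]] r by simp
    show "k z \<in> path_image h \<longleftrightarrow> Re z = 0" if "z \<in> ball 0 1" for z
      unfolding k_def using psi_h[OF scale1[OF that]] r by simp
  qed
qed

lemma connected_in_one_closed:
  assumes "connected S" "closed A" "closed B" "S \<subseteq> A \<union> B" "A \<inter> B \<inter> S = {}"
  shows "S \<subseteq> A - B \<or> S \<subseteq> B - A"
  using assms unfolding connected_closed by blast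

lemma interval_split:
  fixes c :: "real \<Rightarrow> complex"
  assumes c: "continuous_on {-1<..<1} c" "inj_on c {-1<..<1}"
    and G: "closed G1" "closed G2" "G1 \<inter> G2 = {c 0}"
    and sub: "c ` {-1<..<1} \<subseteq> G1 \<union> G2"
    and ex: "s \<in> {-1<..<1}" "s \<noteq> 0" "c s \<in> G1" "t \<in> {-1<..<1}" "t \<noteq> 0" "c t \<in> G2"
  obtains \<sigma> :: real where "\<bar>\<sigma>\<bar> = 1"
    "\<And>t. 0 < t \<Longrightarrow> t < 1 \<Longrightarrow> c (\<sigma> * t) \<in> G1 - G2"
    "\<And>t. 0 < t \<Longrightarrow> t < 1 \<Longrightarrow> c (- \<sigma> * t) \<in> G2 - G1"
proof -
  have no: "c u \<notin> G1 \<inter> G2" if "u \<in> {-1<..<1}" "u \<noteq> 0" for u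
    using c(2) that unfolding G(3) inj_on_def by force
  have half: "c ` I \<subseteq> G1 - G2 \<or> c ` I \<subseteq> G2 - G1"
    if I: "I = {0<..<1} \<or> I = {-1<..<0}" for I
  proof (rule connected_in_one_closed)
    have Isub: "I \<subseteq> {-1<..<1} - {0}" and "connected I" using I by auto
    then show "connected (c ` I)"
      using continuous_on_subset[OF c(1)] by (auto intro!: connected_continuous_image)
    show "c ` I \<subseteq> G1 \<union> G2" "G1 \<inter> G2 \<inter> c ` I = {}" using Isub sub no by blast+
  qed (use G in auto)
  have pos: "u \<in> {0<..<1} \<or> u \<in> {-1<..<0}" if "u \<in> {-1<..<1}" "u \<noteq> 0" for u :: real
    using that by auto
  consider "c ` {0<..<1} \<subseteq> G1 - G2" "c ` {-1<..<0} \<subseteq> G2 - G1"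
    | "c ` {0<..<1} \<subseteq> G2 - G1" "c ` {-1<..<0} \<subseteq> G1 - G2"
    using half[of "{0<..<1}"] half[of "{-1<..<0}"] pos[OF ex(1,2)] pos[OF ex(4,5)] ex by blast
  then show ?thesis
  proof cases
    case 1
    show ?thesis by (rule that[of 1]) (use 1 in \<open>auto simp: image_subset_iff\<close>)
  next
    case 2
    show ?thesis by (rule that[of "-1"]) (use 2 in \<open>auto simp: image_subset_iff\<close>)
  qed
qed

text \<open>
  An arc that is cut at the crossing point meets a chart in an axis; connectedness of the two
  half axes forces each piece of the arc to be exactly one of them. The sign \<open>\<sigma>\<close> records which
  one, so that no orientation of the arcs has to be chosen.
\<close>

lemma crossing_branches:
  assumes \<psi>: "continuous_on (ball 0 1) \<psi>" "inj_on \<psi> (ball 0 1)"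
    "open (\<psi> ` ball (0::complex) 1)" "\<psi> 0 = x"
    and w: "norm w = 1"
    and g: "\<And>z. z \<in> ball 0 1 \<Longrightarrow> \<psi> z \<in> path_image g \<longleftrightarrow> (\<exists>t::real. z = of_real t * w)"
    and cut: "arc_cut g x g1 g2"
  obtains \<sigma> :: real where "\<bar>\<sigma>\<bar> = 1"
    "\<And>t. 0 < t \<Longrightarrow> t < 1 \<Longrightarrow> \<psi> (of_real (\<sigma> * t) * w) \<in> path_image g1 - path_image g2"
    "\<And>t. 0 < t \<Longrightarrow> t < 1 \<Longrightarrow> \<psi> (of_real (- \<sigma> * t) * w) \<in> path_image g2 - path_image g1"
proof -
  define c where "c t = \<psi> (of_real t * w)" for t :: real
  have w0: "w \<noteq> 0" using w by auto
  have in_ball: "of_real t * w \<in> ball 0 1 \<longleftrightarrow> t \<in> {-1<..<1}" for t :: real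
    by (auto simp: norm_mult w)
  have a1: "arc g1" "pathfinish g1 = x" and a2: "arc g2" "pathstart g2 = x"
    and un: "path_image g1 \<union> path_image g2 = path_image g"
    and int: "path_image g1 \<inter> path_image g2 = {x}"
    using cut by (auto simp: arc_cut_def)
  have hit: "\<exists>t\<in>{-1<..<1}. t \<noteq> 0 \<and> c t \<in> G"
    if cl: "x \<in> closure (G - {x})" and sub: "G \<subseteq> path_image g" for G
  proof -
    have "x \<in> \<psi> ` ball 0 1" using \<psi>(4) by force
    then obtain y where "y \<in> G - {x}" "y \<in> \<psi> ` ball 0 1"
      using cl \<psi>(3) unfolding closure_iff_nhds_not_empty by blast
    then obtain z where z: "z \<in> ball 0 1" "\<psi> z \<in> G" "\<psi> z \<noteq> x" by auto
    then obtain t :: real where t: "z = of_real t * w" using g sub by blast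
    then show ?thesis
      using z in_ball \<psi>(4) unfolding c_def by (metis mult_zero_left of_real_0)
  qed
  obtain s where s: "s \<in> {-1<..<1}" "s \<noteq> 0" "c s \<in> path_image g1"
    using hit[of "path_image g1"] arc_minus_finish(2)[OF a1(1)] a1(2) un by blast
  obtain t where t: "t \<in> {-1<..<1}" "t \<noteq> 0" "c t \<in> path_image g2"
    using hit[of "path_image g2"] arc_minus_start(2)[OF a2(1)] a2(2) un by blast
  have "continuous_on {-1<..<1} c"
    unfolding c_def
    by (rule continuous_on_compose2[OF \<psi>(1)]) (auto intro!: continuous_intros simp: norm_mult w)
  moreover have "inj_on c {-1<..<1}"
    using \<psi>(2) in_ball w0 unfolding c_def inj_on_def
    by (metis mult_cancel_right of_real_eq_iff)
  moreover have "c ` {-1<..<1} \<subseteq> path_image g1 \<union> path_image g2"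
    using g in_ball unfolding c_def un by blast
  moreover have "path_image g1 \<inter> path_image g2 = {c 0}" using int \<psi>(4) by (simp add: c_def)
  moreover have "closed (path_image g1)" "closed (path_image g2)"
    using a1 a2 by (auto intro: closed_path_image arc_imp_path)
  ultimately obtain \<sigma> :: real where "\<bar>\<sigma>\<bar> = 1"
    "\<And>t. 0 < t \<Longrightarrow> t < 1 \<Longrightarrow> c (\<sigma> * t) \<in> path_image g1 - path_image g2"
    "\<And>t. 0 < t \<Longrightarrow> t < 1 \<Longrightarrow> c (- \<sigma> * t) \<in> path_image g2 - path_image g1"
    using interval_split[of c "path_image g1" "path_image g2" s t] s t by blast
  then show ?thesis using that unfolding c_def by blast
qed

lemma properly_cross_interior:
  assumes "properly_cross_at g h x"
  shows "x \<in> arc_interior g" "x \<in> arc_interior h"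
  using assms by (auto simp: properly_cross_at_def)

text \<open>
  Suppose that \<open>J\<close> turns at the crossing from the first piece of \<open>g\<close> into the second piece of \<open>h\<close>.
  The two remaining branches bound a quadrant of the chart that \<open>J\<close> avoids, so a chord of this
  quadrant joins them off \<open>J\<close>.
\<close>

lemma crossing_opposite_branches_same_side:
  assumes cross: "properly_cross_at g h x"
    and g: "arc_cut g x g1 g2" and h: "arc_cut h x h1 h2"
    and W: "open W" "x \<in> W" "J \<inter> W \<subseteq> path_image g1 \<union> path_image h2"
    and J: "path_image g2 \<inter> J \<subseteq> {x}" "path_image h1 \<inter> J \<subseteq> {x}"
  shows "connected_component (- J) (pathfinish g) (pathstart h)"
proof -
  obtain \<psi> where \<psi>: "continuous_on (ball 0 1) \<psi>" "inj_on \<psi> (ball 0 1)"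
    "open (\<psi> ` ball 0 1)" "\<psi> ` ball 0 1 \<subseteq> W" "\<psi> 0 = x"
    and pg: "\<And>z. z \<in> ball 0 1 \<Longrightarrow> \<psi> z \<in> path_image g \<longleftrightarrow> Im z = 0"
    and ph: "\<And>z. z \<in> ball 0 1 \<Longrightarrow> \<psi> z \<in> path_image h \<longleftrightarrow> Re z = 0"
    using crossing_chart[OF cross W(1,2)] by metis
  have pg': "\<psi> z \<in> path_image g \<longleftrightarrow> (\<exists>t::real. z = of_real t * 1)" if "z \<in> ball 0 1" for z
    using pg[OF that] by (auto simp: complex_eq_iff intro: exI[of _ "Re z"])
  have ph': "\<psi> z \<in> path_image h \<longleftrightarrow> (\<exists>t::real. z = of_real t * \<i>)" if "z \<in> ball 0 1" for z
    using ph[OF that] by (auto simp: complex_eq_iff intro: exI[of _ "Im z"])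
  obtain \<sigma> :: real where \<sigma>: "\<bar>\<sigma>\<bar> = 1"
    "\<And>t. 0 < t \<Longrightarrow> t < 1 \<Longrightarrow> \<psi> (of_real (- \<sigma> * t) * 1) \<in> path_image g2 - path_image g1"
    using crossing_branches[OF \<psi>(1,2,3,5) norm_one pg' g] by metis
  obtain \<tau> :: real where \<tau>: "\<bar>\<tau>\<bar> = 1"
    "\<And>t. 0 < t \<Longrightarrow> t < 1 \<Longrightarrow> \<psi> (of_real (\<tau> * t) * \<i>) \<in> path_image h1 - path_image h2"
    using crossing_branches[OF \<psi>(1,2,3,5) norm_ii ph' h] by metis
  \<comment> \<open>The ends of the chord: midpoints of the half axes covered by \<open>g2\<close> and by \<open>h1\<close>.\<close>
  define p where "p = complex_of_real (- \<sigma> * (1/2)) * 1"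
  define q where "q = complex_of_real (\<tau> * (1/2)) * \<i>"
  have p: "p \<in> ball 0 1" "\<psi> p \<in> path_image g2 - path_image g1"
    using \<sigma>(1) \<sigma>(2)[of "1/2"] by (auto simp: p_def norm_mult)
  have q: "q \<in> ball 0 1" "\<psi> q \<in> path_image h1 - path_image h2"
    using \<tau>(1) \<tau>(2)[of "1/2"] by (auto simp: q_def norm_mult)
  have segb: "closed_segment p q \<subseteq> ball 0 1"
    using p(1) q(1) by (meson closed_segment_subset convex_ball)
  have x: "x \<in> path_image g1" "x \<in> path_image h2" "path_image g1 \<subseteq> path_image g" "path_image h2 \<subseteq> path_image h"
    using g h by (auto simp: arc_cut_def)
  have "\<psi> z \<notin> J" if z: "z \<in> closed_segment p q" for z
  proof -
    have zb: "z \<in> ball 0 1" using z segb by blast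
    obtain u where u: "0 \<le> u" "u \<le> 1" "z = (1 - u) *\<^sub>R p + u *\<^sub>R q"
      using z by (auto simp: in_segment)
    have re: "Re z = (1 - u) * (- \<sigma> / 2)" and im: "Im z = u * \<tau> / 2"
      unfolding u(3) by (auto simp: p_def q_def)
    have "Re z = 0 \<Longrightarrow> z = q" using re \<sigma>(1) u(3) by auto
    moreover have "Im z = 0 \<Longrightarrow> z = p" using im \<tau>(1) u(3) by auto
    ultimately have "\<psi> z \<notin> path_image g1" "\<psi> z \<notin> path_image h2"
      using pg[OF zb] ph[OF zb] x p(2) q(2) by auto
    then show ?thesis using W(3) \<psi>(4) zb by blast
  qed
  then have "\<psi> ` closed_segment p q \<subseteq> - J" by blast
  moreover have "connected (\<psi> ` closed_segment p q)"
    using continuous_on_subset[OF \<psi>(1) segb] by (auto intro: connected_continuous_image)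
  ultimately have pq: "connected_component (- J) (\<psi> p) (\<psi> q)"
    unfolding connected_component_def by (metis ends_in_segment(1,2) imageI)
  have a: "arc g2" "pathstart g2 = x" "pathfinish g2 = pathfinish g"
     "arc h1" "pathfinish h1 = x" "pathstart h1 = pathstart h"
    using g h by (auto simp: arc_cut_def)
  have "pathfinish g2 \<noteq> x" "pathstart h1 \<noteq> x"
    using a arc_distinct_ends by metis+
  then have "pathfinish g \<in> path_image g2 - {x}" "pathstart h \<in> path_image h1 - {x}"
    using a pathfinish_in_path_image[of g2] pathstart_in_path_image[of h1] by auto
  moreover have "\<psi> p \<in> path_image g2 - {x}" "\<psi> q \<in> path_image h1 - {x}"
    using p q x by auto
  moreover have "connected (path_image g2 - {x})" "connected (path_image h1 - {x})"
    using arc_minus_start(1)[OF a(1)] arc_minus_finish(1)[OF a(4)] a by auto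
  moreover have "path_image g2 - {x} \<subseteq> - J" "path_image h1 - {x} \<subseteq> - J" using J by auto
  ultimately have "connected_component (- J) (pathfinish g) (\<psi> p)"
     "connected_component (- J) (\<psi> q) (pathstart h)"
    unfolding connected_component_def by blast+
  then show ?thesis using pq connected_component_trans by metis
qed

text \<open>
  An arc that meets a Jordan curve in a single proper crossing ends on the other side. Indeed, if
  both half discs of a chart lay in the same component of the complement, then so would a whole
  neighbourhood of the crossing, apart from the curve; but by the Jordan curve theorem each point of the curve
  is in the closure of both the inside and the outside.
\<close>

lemma single_crossing_separates:
  assumes c: "simple_path c" "pathfinish c = pathstart c"
    and h: "arc h" "path_image h \<inter> path_image c = {y}"
    and cross: "properly_cross_at g h y"
    and W: "open W" "y \<in> W" "path_image c \<inter> W = path_image g \<inter> W"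
  shows "\<not> connected_component (- path_image c) (pathstart h) (pathfinish h)"
proof
  assume cc: "connected_component (- path_image c) (pathstart h) (pathfinish h)"
  let ?J = "path_image c"
  obtain \<psi> where \<psi>: "continuous_on (ball 0 1) \<psi>" "inj_on \<psi> (ball 0 1)"
    "open (\<psi> ` ball 0 1)" "\<psi> ` ball 0 1 \<subseteq> W" "\<psi> 0 = y"
    and pg: "\<And>z. z \<in> ball 0 1 \<Longrightarrow> \<psi> z \<in> path_image g \<longleftrightarrow> Im z = 0"
    and ph: "\<And>z. z \<in> ball 0 1 \<Longrightarrow> \<psi> z \<in> path_image h \<longleftrightarrow> Re z = 0"
    using crossing_chart[OF cross W(1,2)] by metis
  have ph': "\<psi> z \<in> path_image h \<longleftrightarrow> (\<exists>t::real. z = of_real t * \<i>)" if "z \<in> ball 0 1" for z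
    using ph[OF that] by (auto simp: complex_eq_iff intro: exI[of _ "Im z"])
  obtain h1 h2 where cut: "arc_cut h y h1 h2"
    using arc_cut_exists[OF h(1)] properly_cross_interior[OF cross] by metis
  obtain \<tau> :: real where \<tau>: "\<bar>\<tau>\<bar> = 1"
    "\<And>t. 0 < t \<Longrightarrow> t < 1 \<Longrightarrow> \<psi> (of_real (\<tau> * t) * \<i>) \<in> path_image h1 - path_image h2"
    "\<And>t. 0 < t \<Longrightarrow> t < 1 \<Longrightarrow> \<psi> (of_real (- \<tau> * t) * \<i>) \<in> path_image h2 - path_image h1"
    using crossing_branches[OF \<psi>(1,2,3,5) norm_ii ph' cut] by metis
  have onJ: "\<psi> z \<in> ?J \<longleftrightarrow> Im z = 0" if "z \<in> ball 0 1" for z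
    using W(3) pg[OF that] \<psi>(4) that by blast
  define p where "p = complex_of_real (\<tau> * (1/2)) * \<i>"
  define q where "q = complex_of_real (- \<tau> * (1/2)) * \<i>"
  have p: "p \<in> ball 0 1" "\<psi> p \<in> path_image h1 - path_image h2"
    using \<tau>(1) \<tau>(2)[of "1/2"] by (auto simp: p_def norm_mult)
  have q: "q \<in> ball 0 1" "\<psi> q \<in> path_image h2 - path_image h1"
    using \<tau>(1) \<tau>(3)[of "1/2"] by (auto simp: q_def norm_mult)
  have a: "arc h2" "pathstart h2 = y" "pathfinish h2 = pathfinish h"
     "arc h1" "pathfinish h1 = y" "pathstart h1 = pathstart h"
     "y \<in> path_image h1" "y \<in> path_image h2"
     "path_image h1 \<subseteq> path_image h" "path_image h2 \<subseteq> path_image h"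
    using cut by (auto simp: arc_cut_def)
  have "pathfinish h2 \<noteq> y" "pathstart h1 \<noteq> y"
    using a arc_distinct_ends by metis+
  then have "pathfinish h \<in> path_image h2 - {y}" "pathstart h \<in> path_image h1 - {y}"
    using a pathfinish_in_path_image[of h2] pathstart_in_path_image[of h1] by auto
  moreover have "\<psi> p \<in> path_image h1 - {y}" "\<psi> q \<in> path_image h2 - {y}"
    using p q a by auto
  moreover have "connected (path_image h2 - {y})" "connected (path_image h1 - {y})"
    using arc_minus_start(1)[OF a(1)] arc_minus_finish(1)[OF a(4)] a by auto
  moreover have "path_image h2 - {y} \<subseteq> - ?J" "path_image h1 - {y} \<subseteq> - ?J" using h(2) a by auto
  ultimately have "connected_component (- ?J) (\<psi> p) (pathstart h)"
     "connected_component (- ?J) (pathfinish h) (\<psi> q)"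
    unfolding connected_component_def by blast+
  then have pq: "connected_component (- ?J) (\<psi> p) (\<psi> q)"
    using cc connected_component_trans by metis
  define P where "P s = {z \<in> ball (0::complex) 1. s * Im z > 0}" for s :: real
  have P: "connected_component (- ?J) u v" if "u \<in> \<psi> ` P s" "v \<in> \<psi> ` P s" for u v s
  proof -
    have "P s = ball 0 1 \<inter> {z. inner (Complex 0 s) z > 0}"
      by (auto simp: P_def inner_complex_def)
    then have "convex (P s)"
      by (simp add: convex_Int convex_halfspace_gt)
    then have "connected (\<psi> ` P s)"
      by (intro connected_continuous_image continuous_on_subset[OF \<psi>(1)])
        (auto simp: P_def convex_connected)
    moreover have "\<psi> ` P s \<subseteq> - ?J" using onJ by (auto simp: P_def)
    ultimately show ?thesis using that unfolding connected_component_def by blast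
  qed
  have pP: "\<psi> p \<in> \<psi> ` P \<tau>" "\<psi> q \<in> \<psi> ` P (- \<tau>)"
    using p(1) q(1) \<tau>(1) by (auto simp: P_def p_def q_def abs_if split: if_splits)
  have all: "connected_component (- ?J) (\<psi> p) u" if "u \<in> \<psi> ` ball 0 1 - ?J" for u
  proof -
    from that obtain z where z: "z \<in> ball 0 1" "u = \<psi> z" "Im z \<noteq> 0" using onJ by auto
    then have "z \<in> P \<tau> \<or> z \<in> P (- \<tau>)"
      using \<tau>(1) by (auto simp: P_def abs_if split: if_splits)
    then show ?thesis
      using P[of _ _ u] pP z pq connected_component_trans[of _ "\<psi> p" "\<psi> q" u] by blast
  qed
  have yN: "y \<in> \<psi> ` ball 0 1" using \<psi>(5) by force
  have yJ: "y \<in> ?J" using h(2) by blast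
  have fr: "frontier (inside ?J) = ?J" "frontier (outside ?J) = ?J"
    using Jordan_inside_outside[OF c] by auto
  have "y \<in> closure (inside ?J)" "y \<in> closure (outside ?J)"
    using fr yJ by (auto simp: frontier_def)
  then have ne: "inside ?J \<inter> \<psi> ` ball 0 1 \<noteq> {}" "outside ?J \<inter> \<psi> ` ball 0 1 \<noteq> {}"
    using yN \<psi>(3) unfolding closure_iff_nhds_not_empty by blast+
  obtain u where u: "u \<in> inside ?J" "u \<in> \<psi> ` ball 0 1" using ne(1) by blast
  obtain v where v: "v \<in> outside ?J" "v \<in> \<psi> ` ball 0 1" using ne(2) by blast
  have "u \<notin> ?J" "v \<notin> ?J" using u v inside_no_overlap outside_no_overlap by fastforce+
  then have "connected_component (- ?J) u v"
    using connected_component_trans[OF connected_component_sym[OF all[of u]] all[of v]] u v by blast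
  then have "v \<in> inside ?J" using u inside_same_component by metis
  then show False using v inside_Int_outside by blast
qed

section \<open>Orderings from acyclic relations\<close>

text \<open>
  Any three consecutive steps of a closed walk of length at least 3 can be shortened by a
  shortcut, so a shortest closed walk has length at most 2, which asymmetry forbids. The fourth
  vertex may coincide with the first one, which covers closed walks of length 3.
\<close>

lemma acyclic_if_shortcuts:
  assumes asym: "\<And>p q. (p, q) \<in> r \<Longrightarrow> (q, p) \<notin> r"
    and short: "\<And>p q s u. (p, q) \<in> r \<Longrightarrow> (q, s) \<in> r \<Longrightarrow> (s, u) \<in> r \<Longrightarrow>
      (p, s) \<in> r \<or> (p, u) \<in> r \<or> (q, u) \<in> r"
  shows "acyclic r"
proof (rule ccontr)
  assume "\<not> acyclic r"
  then obtain x where "(x, x) \<in> r\<^sup>+" by (auto simp: acyclic_def)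
  then have ex: "\<exists>n. n > 0 \<and> (\<exists>x. (x, x) \<in> r ^^ n)" by (meson trancl_power)
  define n where "n = (LEAST n. n > 0 \<and> (\<exists>x. (x, x) \<in> r ^^ n))"
  have n: "n > 0" "\<exists>x. (x, x) \<in> r ^^ n" using LeastI_ex[OF ex] by (auto simp: n_def)
  have min: "(y, y) \<notin> r ^^ m" if "0 < m" "m < n" for m y
    using not_less_Least[of m "\<lambda>n. n > 0 \<and> (\<exists>x. (x, x) \<in> r ^^ n)"] that by (auto simp: n_def)
  obtain p where p: "(p, p) \<in> r ^^ n" using n by blast
  have "n \<noteq> 1" using p asym[of p p] by auto
  moreover have "n \<noteq> 2" using p asym by (auto simp: numeral_2_eq_2)
  ultimately obtain m where m: "n = Suc (Suc (Suc m))"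
    using n(1) by (metis One_nat_def Suc_1 gr0_conv_Suc not0_implies_Suc)
  obtain q where q: "(p, q) \<in> r" "(q, p) \<in> r ^^ Suc (Suc m)"
    using p unfolding m by (meson relpow_Suc_D2)
  obtain s where s: "(q, s) \<in> r" "(s, p) \<in> r ^^ Suc m" using q(2) by (meson relpow_Suc_D2)
  obtain u where u: "(s, u) \<in> r" "(u, p) \<in> r ^^ m" using s(2) by (meson relpow_Suc_D2)
  consider "(p, s) \<in> r" | "(p, u) \<in> r" | "(q, u) \<in> r" using short[OF q(1) s(1) u(1)] by blast
  then show False
  proof cases
    case 1
    then have "(p, p) \<in> r ^^ Suc (Suc m)" using s(2) by (rule relpow_Suc_I2)
    then show False using min m by blast
  next
    case 2
    then have "(p, p) \<in> r ^^ Suc m" using u(2) by (rule relpow_Suc_I2)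
    then show False using min[of "Suc m"] m by simp
  next
    case 3
    then have "(q, p) \<in> r ^^ Suc m" using u(2) by (rule relpow_Suc_I2)
    then have "(p, p) \<in> r ^^ Suc (Suc m)" using q(1) by (meson relpow_Suc_I2)
    then show False using min m by blast
  qed
qed

lemma acyclic_imp_ordering:
  assumes "finite A" "acyclic r"
  shows "\<exists>xs. distinct xs \<and> set xs = A \<and> sorted_wrt (\<lambda>x y. (x, y) \<notin> r) xs"
  using assms(1)
proof (induction A rule: finite_remove_induct)
  case empty
  show ?case by (rule exI[of _ "[]"]) simp
next
  case (remove A)
  have "wf ((r \<inter> A \<times> A)\<inverse>)"
    using remove.hyps assms(2) by (intro finite_acyclic_wf_converse acyclic_subset[OF assms(2)]) auto
  then obtain x where x: "x \<in> A" "\<And>y. (y, x) \<in> (r \<inter> A \<times> A)\<inverse> \<Longrightarrow> y \<notin> A"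
    using remove.hyps by (meson ex_in_conv wfE_min)
  obtain xs where xs: "distinct xs" "set xs = A - {x}" "sorted_wrt (\<lambda>x y. (x, y) \<notin> r) xs"
    using remove.IH x(1) by blast
  have "(x, y) \<notin> r" if "y \<in> A" for y using x(1) x(2)[of y] that by blast
  then have "distinct (x # xs) \<and> set (x # xs) = A \<and> sorted_wrt (\<lambda>x y. (x, y) \<notin> r) (x # xs)"
    using x(1) xs by auto
  then show ?case by blast
qed

section \<open>Crossings between two stars\<close>

lemma arc_cut_meet: "arc_cut g x g1 g2 \<Longrightarrow> y \<in> path_image g1 \<Longrightarrow> y \<in> path_image g2 \<Longrightarrow> y = x"
  unfolding arc_cut_def by blast

text \<open>
  The drawing of a complete bipartite graph with two vertices \<open>b\<close>, \<open>b'\<close> on one side: \<open>e p\<close> and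
  \<open>f p\<close> are the edges that join \<open>b\<close> and \<open>b'\<close> to \<open>a p\<close>.
\<close>

locale two_stars =
  fixes b b' :: complex and I :: "'i set" and a :: "'i \<Rightarrow> complex"
    and e f :: "'i \<Rightarrow> real \<Rightarrow> complex"
  assumes arc_e: "p \<in> I \<Longrightarrow> arc (e p)" "p \<in> I \<Longrightarrow> pathstart (e p) = b" "p \<in> I \<Longrightarrow> pathfinish (e p) = a p"
    and arc_f: "p \<in> I \<Longrightarrow> arc (f p)" "p \<in> I \<Longrightarrow> pathstart (f p) = b'" "p \<in> I \<Longrightarrow> pathfinish (f p) = a p"
    and e_e: "\<lbrakk>p \<in> I; q \<in> I; p \<noteq> q\<rbrakk> \<Longrightarrow> path_image (e p) \<inter> path_image (e q) = {b}"
    and f_f: "\<lbrakk>p \<in> I; q \<in> I; p \<noteq> q\<rbrakk> \<Longrightarrow> path_image (f p) \<inter> path_image (f q) = {b'}"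
    and e_f_same: "p \<in> I \<Longrightarrow> path_image (e p) \<inter> path_image (f p) = {a p}"
    and cross: "\<lbrakk>p \<in> I; q \<in> I; p \<noteq> q; x \<in> path_image (e p) \<inter> path_image (f q)\<rbrakk> \<Longrightarrow>
      properly_cross_at (e p) (f q) x"
    and once: "\<lbrakk>p \<in> I; q \<in> I; p \<noteq> q; x \<in> path_image (e p) \<inter> path_image (f q);
      y \<in> path_image (e p) \<inter> path_image (f q)\<rbrakk> \<Longrightarrow> x = y"
begin

definition crossing :: "('i \<times> 'i) set" where
  "crossing = {(p, q). p \<in> I \<and> q \<in> I \<and> p \<noteq> q \<and> path_image (e p) \<inter> path_image (f q) \<noteq> {}}"

lemma e_e_meet: "\<lbrakk>p \<in> I; q \<in> I; p \<noteq> q; y \<in> path_image (e p); y \<in> path_image (e q)\<rbrakk> \<Longrightarrow> y = b"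
  using e_e by fastforce

lemma f_f_meet: "\<lbrakk>p \<in> I; q \<in> I; p \<noteq> q; y \<in> path_image (f p); y \<in> path_image (f q)\<rbrakk> \<Longrightarrow> y = b'"
  using f_f by fastforce

lemma e_f_meet: "\<lbrakk>p \<in> I; y \<in> path_image (e p); y \<in> path_image (f p)\<rbrakk> \<Longrightarrow> y = a p"
  using e_f_same by fastforce

lemma crossing_point:
  assumes "p \<in> I" "q \<in> I" "p \<noteq> q" "x \<in> path_image (e p)" "x \<in> path_image (f q)"
  shows "x \<noteq> b" "x \<noteq> b'" "x \<noteq> a p" "x \<noteq> a q"
  using properly_cross_interior[OF cross[of p q x]] assms arc_e arc_f
  by (auto simp: arc_interior_def)

lemma b_a_distinct: "p \<in> I \<Longrightarrow> b \<noteq> a p" "p \<in> I \<Longrightarrow> b' \<noteq> a p"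
  using arc_distinct_ends arc_e arc_f by metis+

lemma b'_notin_e: "p \<in> I \<Longrightarrow> b' \<notin> path_image (e p)"
  using e_f_same[of p] arc_f[of p] b_a_distinct[of p] pathstart_in_path_image[of "f p"] by auto

text \<open>
  A crossing of \<open>e p\<close> and \<open>f q\<close> creates a Jordan curve: from \<open>b\<close> along \<open>e p\<close> to the crossing \<open>x\<close>, on
  along \<open>f q\<close> to \<open>a q\<close>, and back to \<open>b\<close> along \<open>e q\<close>. The edges at \<open>b'\<close>
  other than \<open>f q\<close> can meet it only on \<open>e q\<close> and on the part of \<open>e p\<close> up to \<open>x\<close>.
\<close>

lemma jordan_triangle:
  assumes pq: "(p, q) \<in> crossing"
  obtains c x e1 e2 f1 f2 where
    "simple_path c" "pathfinish c = pathstart c"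
    "path_image (e p) \<inter> path_image (f q) = {x}"
    "arc_cut (e p) x e1 e2" "arc_cut (f q) x f1 f2"
    "path_image c = path_image e1 \<union> path_image f2 \<union> path_image (e q)"
proof -
  have I: "p \<in> I" "q \<in> I" "p \<noteq> q" using pq by (auto simp: crossing_def)
  obtain x where x: "x \<in> path_image (e p) \<inter> path_image (f q)" using pq by (auto simp: crossing_def)
  then have xs: "path_image (e p) \<inter> path_image (f q) = {x}" using once[OF I] by auto
  have c: "properly_cross_at (e p) (f q) x" using cross[OF I x] .
  obtain e1 e2 where e12: "arc_cut (e p) x e1 e2"
    using arc_cut_exists arc_e I properly_cross_interior[OF c] by metis
  obtain f1 f2 where f12: "arc_cut (f q) x f1 f2"
    using arc_cut_exists arc_f I properly_cross_interior[OF c] by metis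
  have e1: "arc e1" "pathstart e1 = b" "pathfinish e1 = x" "path_image e1 \<subseteq> path_image (e p)"
    using e12 arc_e I by (auto simp: arc_cut_def)
  have f2: "arc f2" "pathstart f2 = x" "pathfinish f2 = a q" "path_image f2 \<subseteq> path_image (f q)"
    using f12 arc_f I by (auto simp: arc_cut_def)
  have a: "arc (e1 +++ f2)"
    by (rule arc_join) (use e1 f2 xs in auto)
  have im: "path_image (e1 +++ f2) = path_image e1 \<union> path_image f2"
    using e1 f2 by (simp add: path_image_join)
  have "path_image (e1 +++ f2) \<inter> path_image (e q) \<subseteq> {b, a q}"
    unfolding im using e1(4) f2(4) e_e_meet[OF I] e_f_meet[OF I(2)] by blast
  then have "simple_path ((e1 +++ f2) +++ reversepath (e q))"
    by (intro simple_path_join_loop a) (use e1 f2 arc_e I in \<open>auto simp: arc_reversepath\<close>)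
  moreover have "path_image ((e1 +++ f2) +++ reversepath (e q)) =
      path_image e1 \<union> path_image f2 \<union> path_image (e q)"
    using e1 f2 arc_e I im by (simp add: path_image_join)
  moreover have "pathfinish ((e1 +++ f2) +++ reversepath (e q)) = pathstart ((e1 +++ f2) +++ reversepath (e q))"
    using e1 arc_e I by simp
  ultimately show ?thesis using that xs e12 f12 by blast
qed

context
  fixes p q x c e1 e2 f1 f2
  assumes pq: "(p, q) \<in> crossing"
    and c: "simple_path c" "pathfinish c = pathstart c"
    and x: "path_image (e p) \<inter> path_image (f q) = {x}"
    and e12: "arc_cut (e p) x e1 e2" and f12: "arc_cut (f q) x f1 f2"
    and c_eq: "path_image c = path_image e1 \<union> path_image f2 \<union> path_image (e q)"
begin

lemma triangle_facts:
  shows "p \<in> I" "q \<in> I" "p \<noteq> q"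
    "path_image e1 \<subseteq> path_image (e p)" "path_image e2 \<subseteq> path_image (e p)"
    "path_image f1 \<subseteq> path_image (f q)" "path_image f2 \<subseteq> path_image (f q)"
    "x \<noteq> b" "x \<noteq> b'" "x \<noteq> a p" "x \<noteq> a q"
    "b' \<notin> path_image c" "path_image (f p) \<inter> path_image e1 = {}" "x \<notin> path_image (e q)"
proof -
  show I: "p \<in> I" "q \<in> I" "p \<noteq> q" using pq by (auto simp: crossing_def)
  show sub: "path_image e1 \<subseteq> path_image (e p)" "path_image e2 \<subseteq> path_image (e p)"
    "path_image f1 \<subseteq> path_image (f q)" "path_image f2 \<subseteq> path_image (f q)"
    using e12 f12 by (auto simp: arc_cut_def)
  show xn: "x \<noteq> b" "x \<noteq> b'" "x \<noteq> a p" "x \<noteq> a q"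
    using crossing_point[OF I, of x] x by auto
  have "b' \<in> path_image f1"
    using f12 arc_f(2)[OF I(2)] pathstart_in_path_image[of f1] by (auto simp: arc_cut_def)
  then have "b' \<notin> path_image f2" using arc_cut_meet[OF f12] xn by blast
  then show "b' \<notin> path_image c"
    using b'_notin_e I sub by (auto simp: c_eq)
  have "a p \<in> path_image e2"
    using e12 arc_e(3)[OF I(1)] pathfinish_in_path_image[of e2] by (auto simp: arc_cut_def)
  then have "a p \<notin> path_image e1" using arc_cut_meet[OF e12] xn by blast
  then show "path_image (f p) \<inter> path_image e1 = {}"
    using e_f_meet[OF I(1)] sub(1) by blast
  have "x \<in> path_image (e p)" using x by blast
  then show "x \<notin> path_image (e q)" using e_e_meet[OF I] xn(1) by blast
qed

lemma triangle_meet: "y \<in> path_image (e p) \<Longrightarrow> y \<in> path_image (f q) \<Longrightarrow> y = x"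
  using x by blast

text \<open>
  Beyond \<open>x\<close>, the edge \<open>e p\<close> runs off the triangle to \<open>a p\<close>; before \<open>x\<close>, the edge \<open>f q\<close> runs off
  the triangle from \<open>b'\<close>. These are the two opposite branches at the crossing \<open>x\<close>.
\<close>

lemma triangle_same_side:
  "connected_component (- path_image c) (a p) b'"
proof -
  note F = triangle_facts
  have "b \<in> path_image e1"
    using e12 arc_e(2)[OF F(1)] pathstart_in_path_image[of e1] by (auto simp: arc_cut_def)
  then have "b \<notin> path_image e2" using arc_cut_meet[OF e12] F(8) by blast
  then have J2: "path_image e2 \<inter> path_image c \<subseteq> {x}"
    using arc_cut_meet[OF e12] triangle_meet F(5,7) e_e_meet[OF F(1-3)] \<open>b \<notin> path_image e2\<close> unfolding c_eq by blast
  have "a q \<in> path_image f2"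
    using f12 arc_f(3)[OF F(2)] pathfinish_in_path_image[of f2] by (auto simp: arc_cut_def)
  then have "a q \<notin> path_image f1" using arc_cut_meet[OF f12] F(11) by blast
  then have J1: "path_image f1 \<inter> path_image c \<subseteq> {x}"
    using arc_cut_meet[OF f12] triangle_meet F(4,6) e_f_meet[OF F(2)] \<open>a q \<notin> path_image f1\<close> unfolding c_eq by blast
  have op: "open (- path_image (e q))"
    using arc_e F by (auto intro!: closed_path_image arc_imp_path)
  have "properly_cross_at (e p) (f q) x" using cross[OF F(1-3)] x by blast
  moreover have "path_image c \<inter> - path_image (e q) \<subseteq> path_image e1 \<union> path_image f2"
    unfolding c_eq by blast
  ultimately have "connected_component (- path_image c) (pathfinish (e p)) (pathstart (f q))"
    using crossing_opposite_branches_same_side[OF _ e12 f12 op _ _ J2 J1] F(14) by blast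
  then show ?thesis using arc_e(3)[OF F(1)] arc_f(2)[OF F(2)] by simp
qed

text \<open>
  An edge \<open>f s\<close> that crosses \<open>e q\<close> but avoids the part of \<open>e p\<close> before \<open>x\<close> meets the triangle in
  that one crossing only, because it meets \<open>f q\<close> in \<open>b'\<close>, which is not on the triangle.
\<close>

lemma triangle_separates:
  assumes qs: "(q, s) \<in> crossing" and s: "path_image (f s) \<inter> path_image e1 = {}"
  shows "\<not> connected_component (- path_image c) b' (a s)"
proof -
  note F = triangle_facts
  have I: "s \<in> I" "q \<noteq> s" using qs by (auto simp: crossing_def)
  obtain y where y: "path_image (e q) \<inter> path_image (f s) = {y}"
    using qs once[OF F(2) I] by (fastforce simp: crossing_def)
  have yn: "y \<noteq> b" "y \<noteq> a q" using crossing_point[OF F(2) I, of y] y by auto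
  have int: "path_image (f s) \<inter> path_image c = {y}"
  proof
    show "{y} \<subseteq> path_image (f s) \<inter> path_image c" using y unfolding c_eq by blast
    have "z = y" if z: "z \<in> path_image (f s)" "z \<in> path_image c" for z
    proof -
      have "z \<notin> path_image e1" using s z by blast
      moreover have "z \<notin> path_image f2" using f_f_meet[OF F(2) I] F(7,12) z by blast
      ultimately have "z \<in> path_image (e q)" using z unfolding c_eq by blast
      then show ?thesis using y z by blast
    qed
    then show "path_image (f s) \<inter> path_image c \<subseteq> {y}" by blast
  qed
  have "closed (path_image e1 \<union> path_image f2)"
    using e12 f12 by (auto simp: arc_cut_def intro!: closed_path_image arc_imp_path)
  then have op: "open (- (path_image e1 \<union> path_image f2))" by (rule open_Compl)
  have "y \<notin> path_image e1" using e_e_meet[OF F(1-3)] y yn(1) F(4) by blast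
  moreover have "y \<notin> path_image f2" using e_f_meet[OF F(2)] y yn(2) F(7) by blast
  moreover have "properly_cross_at (e q) (f s) y" using cross[OF F(2) I] y by blast
  moreover have "path_image c \<inter> - (path_image e1 \<union> path_image f2) =
      path_image (e q) \<inter> - (path_image e1 \<union> path_image f2)"
    unfolding c_eq by blast
  ultimately have "\<not> connected_component (- path_image c) (pathstart (f s)) (pathfinish (f s))"
    using single_crossing_separates[OF c arc_f(1)[OF I(1)] int _ op] by blast
  then show ?thesis using arc_f[OF I(1)] by simp
qed

end

text \<open>
  If also \<open>e q\<close> and \<open>f p\<close> crossed, then \<open>f p\<close> would lead from \<open>b'\<close> to \<open>a p\<close> and cross the triangle
  exactly once, whereas its two ends are on the same side.
\<close>

lemma crossing_asym:
  assumes pq: "(p, q) \<in> crossing" shows "(q, p) \<notin> crossing"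
proof
  assume qp: "(q, p) \<in> crossing"
  obtain c x e1 e2 f1 f2 where t: "simple_path c" "pathfinish c = pathstart c"
    "path_image (e p) \<inter> path_image (f q) = {x}"
    "arc_cut (e p) x e1 e2" "arc_cut (f q) x f1 f2"
    "path_image c = path_image e1 \<union> path_image f2 \<union> path_image (e q)"
    using jordan_triangle[OF pq] by metis
  show False
    using triangle_same_side[OF pq t] triangle_separates[OF pq t qp] triangle_facts(13)[OF pq t]
      connected_component_sym by metis
qed

text \<open>
  Without any of the shortcuts, \<open>f r\<close> crosses the triangle of \<open>p\<close> and \<open>q\<close> exactly once, so that
  \<open>b'\<close> and \<open>a r\<close> are on different sides. But \<open>f u\<close> avoids the triangle, and so does \<open>e r\<close>
  except at \<open>b\<close>; since these two edges cross, they connect \<open>b'\<close> to \<open>a r\<close> off the triangle.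
\<close>

lemma crossing_shortcut:
  assumes pq: "(p, q) \<in> crossing" and qr: "(q, r) \<in> crossing" and ru: "(r, u) \<in> crossing"
  shows "(p, r) \<in> crossing \<or> (p, u) \<in> crossing \<or> (q, u) \<in> crossing"
proof (rule ccontr)
  assume no: "\<not> ?thesis"
  obtain c x e1 e2 f1 f2 where t: "simple_path c" "pathfinish c = pathstart c"
    "path_image (e p) \<inter> path_image (f q) = {x}"
    "arc_cut (e p) x e1 e2" "arc_cut (f q) x f1 f2"
    "path_image c = path_image e1 \<union> path_image f2 \<union> path_image (e q)"
    using jordan_triangle[OF pq] by metis
  note F = triangle_facts[OF pq t]
  have I: "r \<in> I" "u \<in> I" "q \<noteq> r" "r \<noteq> u" using qr ru by (auto simp: crossing_def)
  have rp: "r \<noteq> p" and uq: "u \<noteq> q" using crossing_asym pq qr ru by blast+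
  have "path_image (e p) \<inter> path_image (f r) = {}"
    using no rp F(1) I by (auto simp: crossing_def)
  then have sep: "\<not> connected_component (- path_image c) b' (a r)"
    using triangle_separates[OF pq t qr] F by blast
  obtain w where w: "w \<in> path_image (e r)" "w \<in> path_image (f u)" using ru by (auto simp: crossing_def)
  have wb: "w \<noteq> b" using crossing_point[OF I(1,2,4) w] by blast
  \<comment> \<open>If \<open>u = p\<close>, then \<open>f u\<close> does meet \<open>e p\<close>, but only in its endpoint beyond \<open>x\<close>.\<close>
  have "path_image (f u) \<inter> path_image e1 = {}"
  proof (cases "u = p")
    case True
    then show ?thesis using F by simp
  next
    case False
    then have "path_image (e p) \<inter> path_image (f u) = {}" using no F I by (auto simp: crossing_def)
    then show ?thesis using F by blast
  qed
  moreover have "path_image (e q) \<inter> path_image (f u) = {}" using no uq F I by (auto simp: crossing_def)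
  moreover have "path_image (f u) \<inter> path_image f2 = {}"
    using f_f_meet[OF I(2) F(2) uq] F(7,12) t(6) by blast
  ultimately have "path_image (f u) \<subseteq> - path_image c" unfolding t(6) by blast
  moreover have "connected (path_image (f u))" "b' \<in> path_image (f u)"
    using arc_f[OF I(2)] pathstart_in_path_image[of "f u"]
    by (auto intro: connected_path_image arc_imp_path)
  ultimately have 1: "connected_component (- path_image c) b' w"
    using w unfolding connected_component_def by blast
  have "path_image (e r) \<inter> path_image (f q) = {}"
    using crossing_asym[OF qr] F I by (auto simp: crossing_def)
  then have "path_image (e r) - {b} \<subseteq> - path_image c"
    using e_e_meet[OF I(1) F(1) rp] e_e_meet[OF F(2) I(1,3)] F(4,7) unfolding t(6) by blast
  moreover have "connected (path_image (e r) - {b})"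
    using arc_minus_start(1) arc_e I by metis
  moreover have "a r \<in> path_image (e r) - {b}"
    using arc_e[OF I(1)] b_a_distinct[OF I(1)] pathfinish_in_path_image[of "e r"] by auto
  moreover have "w \<in> path_image (e r) - {b}" using w wb by blast
  ultimately have "connected_component (- path_image c) w (a r)"
    unfolding connected_component_def by blast
  then show False using 1 sep connected_component_trans by metis
qed

lemma acyclic_crossing: "acyclic crossing"
  using acyclic_if_shortcuts[of crossing] crossing_asym crossing_shortcut by blast

end

section \<open>Edges in graphs without large complete bipartite subgraphs\<close>

lemma sum_power_le:
  fixes f :: "'a \<Rightarrow> real"
  assumes "finite S" "\<And>x. x \<in> S \<Longrightarrow> 0 \<le> f x" "k > 0"
  shows "(\<Sum>x\<in>S. f x) ^ k \<le> real (card S) ^ (k - 1) * (\<Sum>x\<in>S. f x ^ k)"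
proof (cases "S = {}")
  case True
  then show ?thesis using assms(3) by (simp add: zero_power)
next
  case False
  define n where "n = real (card S)"
  have n: "n > 0" using False assms(1) by (simp add: n_def card_gt_0_iff)
  have conv: "convex_on {0..} (\<lambda>x::real. x ^ k)"
  proof (cases "even k")
    case True
    then show ?thesis using convex_on_subset[OF convex_power_even[OF True]] by auto
  next
    case False
    then show ?thesis using convex_power_odd by blast
  qed
  have "(\<Sum>x\<in>S. (1 / n) *\<^sub>R f x) ^ k \<le> (\<Sum>x\<in>S. (1 / n) * f x ^ k)"
    by (rule convex_on_sum[OF assms(1) False conv]) (use n assms in \<open>auto simp: n_def\<close>)
  then have "(\<Sum>x\<in>S. f x) ^ k / n ^ k \<le> (\<Sum>x\<in>S. f x ^ k) / n"
    by (simp add: sum_divide_distrib[symmetric] power_divide)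
  then have "(\<Sum>x\<in>S. f x) ^ k \<le> (\<Sum>x\<in>S. f x ^ k) / n * n ^ k"
    using n by (simp add: field_simps)
  also have "n ^ k = n * n ^ (k - 1)" using assms(3) by (simp add: power_eq_if)
  finally show ?thesis using n unfolding n_def by (simp add: mult.commute)
qed

text \<open>
  Count the pairs of a vertex \<open>v\<close> and an \<open>s\<close>-set of neighbours of \<open>v\<close>. Since there is no complete
  bipartite subgraph, each of the at most \<open>n ^ s\<close> sets has at most \<open>t\<close> common neighbours,
  while by convexity the number of pairs is roughly at least \<open>n * (d / s) ^ s\<close>, where \<open>d\<close> is the
  average degree. The sets \<open>A\<close> and \<open>B\<close> are automatically disjoint, since edges have
  two elements.
\<close>

lemma kovari_sos_turan:
  fixes V :: "'a set"
  assumes V: "finite V" and E: "\<And>e. e \<in> E \<Longrightarrow> e \<subseteq> V \<and> card e = 2" and s: "s > 0"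
    and free: "\<not> (\<exists>A B. A \<subseteq> V \<and> B \<subseteq> V \<and> card A = s \<and> card B = t \<and> (\<forall>x\<in>A. \<forall>y\<in>B. {x, y} \<in> E))"
  shows "real (card E) \<le> real ((t + 1) * s) * real (card V) powr (2 - 1 / real s)"
proof -
  define n where "n = card V"
  define N where "N v = {u \<in> V. {u, v} \<in> E}" for v
  define P where "P = {S. S \<subseteq> V \<and> card S = s}"
  have finN: "finite (N v)" for v using V by (simp add: N_def)
  have finP: "finite P" using V by (simp add: P_def)
  have "E \<subseteq> (\<lambda>(v, u). {u, v}) ` (SIGMA v:V. N v)"
  proof
    fix e assume e: "e \<in> E"
    then obtain u v where uv: "e = {u, v}" using E card_2_iff by metis
    then have "(v, u) \<in> (SIGMA v:V. N v)" using e E by (auto simp: N_def)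
    then show "e \<in> (\<lambda>(v, u). {u, v}) ` (SIGMA v:V. N v)" unfolding uv by force
  qed
  then have "card E \<le> card (SIGMA v:V. N v)"
    by (rule surj_card_le[rotated]) (use V finN in auto)
  then have cardE: "real (card E) \<le> (\<Sum>v\<in>V. real (card (N v)))"
    using V finN by (simp flip: of_nat_sum)

  have common: "card {v \<in> V. S \<subseteq> N v} \<le> t" if "S \<in> P" for S
  proof (rule ccontr)
    assume "\<not> ?thesis"
    then obtain B where B: "B \<subseteq> {v \<in> V. S \<subseteq> N v}" "card B = t"
      by (metis nat_le_linear obtain_subset_with_card_n)
    then have "\<forall>x\<in>S. \<forall>y\<in>B. {x, y} \<in> E" by (auto simp: N_def)
    moreover have "S \<subseteq> V" "card S = s" "B \<subseteq> V" using that B by (auto simp: P_def)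
    ultimately show False using free B(2) by blast
  qed
  have "(\<Sum>v\<in>V. card (N v) choose s) = (\<Sum>v\<in>V. \<Sum>S\<in>{S \<in> P. S \<subseteq> N v}. 1)"
  proof (rule sum.cong[OF refl])
    fix v
    have "{S \<in> P. S \<subseteq> N v} = {S. S \<subseteq> N v \<and> card S = s}" by (auto simp: P_def N_def)
    then show "(card (N v) choose s) = (\<Sum>S\<in>{S \<in> P. S \<subseteq> N v}. 1)"
      using n_subsets[OF finN] by simp
  qed
  also have "\<dots> = (\<Sum>S\<in>P. \<Sum>v\<in>{v \<in> V. S \<subseteq> N v}. 1)"
    by (rule sum.swap_restrict[OF V finP])
  also have "\<dots> \<le> (\<Sum>S\<in>P. t)" using common by (intro sum_mono) simp
  also have "\<dots> = t * (n choose s)" using n_subsets[OF V] by (simp add: P_def n_def)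
  also have "\<dots> \<le> t * n ^ s"
  proof (cases "s \<le> n")
    case True
    then show ?thesis using binomial_le_pow by simp
  qed (simp add: binomial_eq_0)
  finally have cnt: "(\<Sum>v\<in>V. card (N v) choose s) \<le> t * n ^ s" .

  \<comment> \<open>The summand 1 covers degrees below \<open>s\<close>, where the binomial coefficient vanishes.\<close>
  have low: "(real d / real s) ^ s \<le> real (d choose s) + 1" for d
  proof (cases "s \<le> d")
    case True
    then show ?thesis using binomial_ge_n_over_k_pow_k[OF True, where 'a = real] by simp
  next
    case False
    then have "(real d / real s) ^ s \<le> 1" by (intro power_le_one) auto
    then show ?thesis by (meson add_increasing of_nat_0_le_iff)
  qed
  have "n \<le> n ^ s" using s by (cases "n = 0") (simp_all add: self_le_power)
  have "(\<Sum>v\<in>V. (real (card (N v)) / real s) ^ s) \<le> (\<Sum>v\<in>V. real (card (N v) choose s) + 1)"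
    by (intro sum_mono low)
  also have "\<dots> = real (\<Sum>v\<in>V. card (N v) choose s) + real n"
    by (simp add: sum.distrib n_def)
  also have "\<dots> \<le> real (t * n ^ s) + real (n ^ s)"
    using cnt \<open>n \<le> n ^ s\<close> by (intro add_mono of_nat_mono)
  finally have "(\<Sum>v\<in>V. (real (card (N v)) / real s) ^ s) \<le> real (t + 1) * real n ^ s"
    by (simp add: algebra_simps)
  then have pw: "(\<Sum>v\<in>V. real (card (N v)) / real s) ^ s \<le> real n ^ (s - 1) * (real (t + 1) * real n ^ s)"
    using sum_power_le[OF V, of "\<lambda>v. real (card (N v)) / real s" s] s
    unfolding n_def by (smt (verit, best) divide_nonneg_nonneg mult_left_mono of_nat_0_le_iff zero_le_power)
  define r where "r = real n powr (2 - 1 / real s)"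
  have rs: "r ^ s = real n ^ (s - 1) * real n ^ s"
  proof (cases "n = 0")
    case True
    then show ?thesis using s by (simp add: r_def)
  next
    case False
    then have "r ^ s = real n powr ((2 - 1 / real s) * real s)"
      by (simp add: r_def powr_powr[symmetric] powr_realpow)
    also have "(2 - 1 / real s) * real s = real ((s - 1) + s)"
      using s by (simp add: algebra_simps of_nat_diff)
    finally show ?thesis using False by (simp add: powr_realpow power_add del: of_nat_add)
  qed
  have "real (t + 1) \<le> real (t + 1) ^ s" using s by (intro self_le_power) auto
  then have "(\<Sum>v\<in>V. real (card (N v)) / real s) ^ s \<le> (real (t + 1) * r) ^ s"
    using pw mult_right_mono[of "real (t + 1)" "real (t + 1) ^ s" "r ^ s"]
    unfolding power_mult_distrib rs by (simp add: mult_ac)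
  then have "(\<Sum>v\<in>V. real (card (N v)) / real s) \<le> real (t + 1) * r"
    using s by (subst (asm) power_mono_iff) (auto simp: r_def intro!: sum_nonneg)
  then have "(\<Sum>v\<in>V. real (card (N v))) \<le> real (t + 1) * r * real s"
    using s by (simp add: sum_divide_distrib[symmetric] pos_divide_le_eq)
  then show ?thesis using cardE unfolding r_def n_def by (simp add: algebra_simps)
qed

section \<open>Ramsey's theorem for ordered pairs\<close>

text \<open>
  Ramsey's theorem for colours in an arbitrary finite set that may depend on the order of
  the two elements of a pair: an unordered pair gets the colour of its increasing arrangement.
\<close>

lemma ramsey_ordered_pairs:
  fixes C :: "'c set" and m :: nat
  assumes "finite C"
  obtains N :: nat where "\<And>c. (\<And>i j. i < j \<Longrightarrow> j < N \<Longrightarrow> c i j \<in> C) \<Longrightarrow>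
    \<exists>H col. H \<subseteq> {..<N} \<and> card H = m \<and> col \<in> C \<and> (\<forall>i\<in>H. \<forall>j\<in>H. i < j \<longrightarrow> c i j = col)"
proof -
  obtain h where h: "bij_betw h C {0..<card C}" using ex_bij_betw_finite_nat assms by blast
  obtain N where N: "partn_lst {..<N::nat} (replicate (card C) m) 2" using ramsey_full by blast
  show ?thesis
  proof (rule that[of N])
    fix c :: "nat \<Rightarrow> nat \<Rightarrow> 'c" assume c: "\<And>i j. i < j \<Longrightarrow> j < N \<Longrightarrow> c i j \<in> C"
    define F where "F S = h (c (Min S) (Max S))" for S
    have F: "F {i, j} = h (c i j)" if "i < j" for i j using that by (simp add: F_def max_def)
    have "F S \<in> {..<card C}" if S: "S \<in> nsets {..<N} 2" for S
    proof -
      obtain i j where ij: "S = {i, j}" "i < j" "j < N"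
        using S by (auto simp: ordered_nsets_2_eq)
      then show ?thesis using c[OF ij(2,3)] F[OF ij(2)] bij_betwE[OF h] by auto
    qed
    then have "F \<in> nsets {..<N} 2 \<rightarrow> {..<length (replicate (card C) m)}" by auto
    then obtain i where i: "i < card C" "monochromatic {..<N} (replicate (card C) m ! i) 2 F i"
      using N by (auto simp: partn_lst_def)
    then obtain H where H: "H \<in> nsets {..<N} m" "F ` nsets H 2 \<subseteq> {i}"
      by (auto simp: monochromatic_def)
    obtain col where col: "col \<in> C" "h col = i" using bij_betw_imp_surj_on[OF h] i(1) by (metis atLeast0LessThan imageE lessThan_iff)
    have "c x y = col" if xy: "x \<in> H" "y \<in> H" "x < y" for x y
    proof -
      have "{x, y} \<in> nsets H 2" using xy by simp
      then have "F {x, y} = i" using H(2) by blast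
      moreover have "c x y \<in> C" using c[OF xy(3)] xy H(1) by (auto simp: nsets_def)
      ultimately show ?thesis
        using F[OF xy(3)] col bij_betw_imp_inj_on[OF h] by (auto dest: inj_onD)
    qed
    then show "\<exists>H col. H \<subseteq> {..<N} \<and> card H = m \<and> col \<in> C \<and> (\<forall>i\<in>H. \<forall>j\<in>H. i < j \<longrightarrow> c i j = col)"
      using H(1) col(1) by (auto simp: nsets_def)
  qed
qed

section \<open>Plane paths in simple topological graphs\<close>

lemma disjoint_images_dont_cross:
  assumes "path_image g \<inter> path_image h = {}"
  shows "\<not> arcs_cross g h"
  using assms properly_cross_interior unfolding arcs_cross_def arc_interior_def by blast

text \<open>
  In a topological graph an edge has no preferred direction, whereas the topological arguments
  speak of stars whose arcs leave their centre.
\<close>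

definition directed_arc :: "(complex set \<Rightarrow> real \<Rightarrow> complex) \<Rightarrow> complex \<Rightarrow> complex \<Rightarrow> real \<Rightarrow> complex" where
  "directed_arc \<gamma> u v =
     (if pathstart (\<gamma> {u, v}) = u then \<gamma> {u, v} else reversepath (\<gamma> {u, v}))"

context
  fixes V E \<gamma>
  assumes G: "simple_topological_graph V E \<gamma>"
begin

lemma edge_subset: "e \<in> E \<Longrightarrow> e \<subseteq> V" and edge_card: "e \<in> E \<Longrightarrow> card e = 2"
  and edge_arc: "e \<in> E \<Longrightarrow> arc (\<gamma> e)" "e \<in> E \<Longrightarrow> {pathstart (\<gamma> e), pathfinish (\<gamma> e)} = e"
  and edge_interior_no_vertex: "e \<in> E \<Longrightarrow> arc_interior (\<gamma> e) \<inter> V = {}"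
proof -
  have "(\<forall>e\<in>E. e \<subseteq> V \<and> card e = 2) \<and>
    (\<forall>e\<in>E. arc (\<gamma> e) \<and> {pathstart (\<gamma> e), pathfinish (\<gamma> e)} = e) \<and>
    (\<forall>e\<in>E. arc_interior (\<gamma> e) \<inter> V = {})"
    using G unfolding simple_topological_graph_def topological_graph_def
    by (elim conjE, intro conjI)
  then show "e \<in> E \<Longrightarrow> e \<subseteq> V" "e \<in> E \<Longrightarrow> card e = 2" "e \<in> E \<Longrightarrow> arc (\<gamma> e)"
    "e \<in> E \<Longrightarrow> {pathstart (\<gamma> e), pathfinish (\<gamma> e)} = e"
    "e \<in> E \<Longrightarrow> arc_interior (\<gamma> e) \<inter> V = {}"
    by blast+
qed

lemma edge_interior: "e \<in> E \<Longrightarrow> arc_interior (\<gamma> e) = path_image (\<gamma> e) - e"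
  unfolding arc_interior_def by (simp only: edge_arc(2))

lemma edge_ends_in_image: "e \<in> E \<Longrightarrow> e \<subseteq> path_image (\<gamma> e)"
  by (metis edge_arc(2) empty_subsetI insert_subset pathfinish_in_path_image pathstart_in_path_image)

lemma edges_meet_once:
  "\<lbrakk>e \<in> E; f \<in> E; e \<noteq> f; x \<in> path_image (\<gamma> e) \<inter> path_image (\<gamma> f);
    y \<in> path_image (\<gamma> e) \<inter> path_image (\<gamma> f)\<rbrakk> \<Longrightarrow> x = y"
  using G unfolding simple_topological_graph_def by blast

lemma adjacent_edges_meet:
  assumes "e \<in> E" "f \<in> E" "e \<noteq> f" "v \<in> e" "v \<in> f"
  shows "path_image (\<gamma> e) \<inter> path_image (\<gamma> f) = {v}"
proof -
  have v: "v \<in> path_image (\<gamma> e) \<inter> path_image (\<gamma> f)" using edge_ends_in_image assms by blast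
  show ?thesis
  proof (intro equalityI subsetI)
    fix x assume "x \<in> path_image (\<gamma> e) \<inter> path_image (\<gamma> f)"
    then have "x = v" using v by (rule edges_meet_once[OF assms(1-3)])
    then show "x \<in> {v}" by simp
  qed (use v in simp)
qed

lemma disjoint_edges_cross:
  assumes "e \<in> E" "f \<in> E" "e \<inter> f = {}" "x \<in> path_image (\<gamma> e) \<inter> path_image (\<gamma> f)"
  shows "properly_cross_at (\<gamma> e) (\<gamma> f) x"
proof -
  have ne: "e \<noteq> f" using assms edge_card[OF assms(1)] by auto
  have "x \<notin> e" "x \<notin> f"
    using assms edge_interior_no_vertex[of e] edge_interior_no_vertex[of f]
      edge_subset[of e] edge_subset[of f] edge_interior[of e] edge_interior[of f] by blast+
  then have "x \<in> arc_interior (\<gamma> e) \<inter> arc_interior (\<gamma> f)" using edge_interior assms by blast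
  then show ?thesis using G assms ne by (auto simp: simple_topological_graph_def topological_graph_def)
qed

lemma adjacent_edges_dont_cross:
  assumes "e \<in> E" "f \<in> E" "e \<noteq> f" "v \<in> e" "v \<in> f"
  shows "\<not> arcs_cross (\<gamma> e) (\<gamma> f)"
proof
  assume "arcs_cross (\<gamma> e) (\<gamma> f)"
  then obtain x where x: "x \<in> arc_interior (\<gamma> e)" "x \<in> arc_interior (\<gamma> f)"
    unfolding arcs_cross_def by (blast dest: properly_cross_interior)
  then have "x = v"
    using adjacent_edges_meet[OF assms] by (auto simp: arc_interior_def)
  then show False using x(1) edge_interior assms by blast
qed

lemma directed_arc:
  assumes "{u, v} \<in> E"
  shows "arc (directed_arc \<gamma> u v)" "pathstart (directed_arc \<gamma> u v) = u"
    "pathfinish (directed_arc \<gamma> u v) = v" "path_image (directed_arc \<gamma> u v) = path_image (\<gamma> {u, v})"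
    "arc_interior (directed_arc \<gamma> u v) = arc_interior (\<gamma> {u, v})"
proof -
  let ?g = "\<gamma> {u, v}"
  have g: "arc ?g" "{pathstart ?g, pathfinish ?g} = {u, v}" by (fact edge_arc[OF assms])+
  have "pathstart ?g = u \<and> pathfinish ?g = v \<or> pathstart ?g = v \<and> pathfinish ?g = u"
    using g(2) unfolding doubleton_eq_iff .
  then have ends: "pathfinish ?g = (if pathstart ?g = u then v else u)"
    "pathstart ?g = u \<or> pathstart ?g = v"
    using arc_distinct_ends[OF g(1)] by auto
  show "arc (directed_arc \<gamma> u v)" using g(1) by (simp add: directed_arc_def arc_reversepath)
  show "pathstart (directed_arc \<gamma> u v) = u" "pathfinish (directed_arc \<gamma> u v) = v"
    using ends by (auto simp: directed_arc_def)
  show "path_image (directed_arc \<gamma> u v) = path_image ?g" by (simp add: directed_arc_def)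
  show "arc_interior (directed_arc \<gamma> u v) = arc_interior ?g"
    by (simp add: directed_arc_def arc_interior_def insert_commute)
qed

lemma properly_cross_at_directed_arc:
  assumes "{u, v} \<in> E" "{w, z} \<in> E" "properly_cross_at (\<gamma> {u, v}) (\<gamma> {w, z}) x"
  shows "properly_cross_at (directed_arc \<gamma> u v) (directed_arc \<gamma> w z) x"
  using assms(3)
  unfolding properly_cross_at_def directed_arc(4,5)[OF assms(1)] directed_arc(4,5)[OF assms(2)] .

lemma two_stars_of_graph:
  assumes b: "b \<noteq> b'" and a: "inj_on a I"
    and E: "\<And>p. p \<in> I \<Longrightarrow> {b, a p} \<in> E" "\<And>p. p \<in> I \<Longrightarrow> {b', a p} \<in> E"
  shows "two_stars b b' I a (\<lambda>p. directed_arc \<gamma> b (a p)) (\<lambda>p. directed_arc \<gamma> b' (a p))"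
proof
  have ab: "a p \<noteq> b" "a p \<noteq> b'" if "p \<in> I" for p
    using edge_card[OF E(1)[OF that]] edge_card[OF E(2)[OF that]] by auto
  show "path_image (directed_arc \<gamma> b (a p)) \<inter> path_image (directed_arc \<gamma> b (a q)) = {b}"
    if "p \<in> I" "q \<in> I" "p \<noteq> q" for p q
    unfolding directed_arc(4)[OF E(1)[OF that(1)]] directed_arc(4)[OF E(1)[OF that(2)]]
    by (rule adjacent_edges_meet) (use E that a in \<open>auto simp: doubleton_eq_iff dest: inj_onD\<close>)
  show "path_image (directed_arc \<gamma> b' (a p)) \<inter> path_image (directed_arc \<gamma> b' (a q)) = {b'}"
    if "p \<in> I" "q \<in> I" "p \<noteq> q" for p q
    unfolding directed_arc(4)[OF E(2)[OF that(1)]] directed_arc(4)[OF E(2)[OF that(2)]]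
    by (rule adjacent_edges_meet) (use E that a in \<open>auto simp: doubleton_eq_iff dest: inj_onD\<close>)
  show "path_image (directed_arc \<gamma> b (a p)) \<inter> path_image (directed_arc \<gamma> b' (a p)) = {a p}"
    if "p \<in> I" for p
    unfolding directed_arc(4)[OF E(1)[OF that]] directed_arc(4)[OF E(2)[OF that]]
    by (rule adjacent_edges_meet) (use E that b in \<open>auto simp: doubleton_eq_iff\<close>)
  fix p q x assume I: "p \<in> I" "q \<in> I" "p \<noteq> q"
    and x: "x \<in> path_image (directed_arc \<gamma> b (a p)) \<inter> path_image (directed_arc \<gamma> b' (a q))"
  have disj: "{b, a p} \<inter> {b', a q} = {}"
    using ab[OF I(1)] ab[OF I(2)] b I a by (auto dest: inj_onD)
  show "properly_cross_at (directed_arc \<gamma> b (a p)) (directed_arc \<gamma> b' (a q)) x"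
    using disjoint_edges_cross[OF E(1)[OF I(1)] E(2)[OF I(2)] disj] x
      directed_arc(4)[OF E(1)[OF I(1)]] directed_arc(4)[OF E(2)[OF I(2)]]
    by (intro properly_cross_at_directed_arc E I) auto
  fix y assume y: "y \<in> path_image (directed_arc \<gamma> b (a p)) \<inter> path_image (directed_arc \<gamma> b' (a q))"
  have "{b, a p} \<noteq> {b', a q}" using disj by auto
  then show "x = y"
    using edges_meet_once[OF E(1)[OF I(1)] E(2)[OF I(2)]] x y
    unfolding directed_arc(4)[OF E(1)[OF I(1)]] directed_arc(4)[OF E(2)[OF I(2)]] by blast
qed (use directed_arc E in auto)

text \<open>
  The crossing relation of two stars is acyclic, so its domain can be listed with all arrows
  pointing backwards.
\<close>

lemma ordering_without_forward_crossings:
  assumes b: "b \<noteq> b'" and a: "inj_on a I" and I: "finite I"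
    and E: "\<And>p. p \<in> I \<Longrightarrow> {b, a p} \<in> E" "\<And>p. p \<in> I \<Longrightarrow> {b', a p} \<in> E"
  shows "\<exists>xs. distinct xs \<and> set xs = I \<and>
    sorted_wrt (\<lambda>p q. path_image (\<gamma> {b, a p}) \<inter> path_image (\<gamma> {b', a q}) = {}) xs"
proof -
  interpret two_stars b b' I a "\<lambda>p. directed_arc \<gamma> b (a p)" "\<lambda>p. directed_arc \<gamma> b' (a p)"
    by (rule two_stars_of_graph[OF b a E])
  obtain xs where xs: "distinct xs" "set xs = I" "sorted_wrt (\<lambda>x y. (x, y) \<notin> crossing) xs"
    using acyclic_imp_ordering[OF I acyclic_crossing] by blast
  have "path_image (\<gamma> {b, a (xs ! i)}) \<inter> path_image (\<gamma> {b', a (xs ! j)}) = {}"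
    if ij: "i < j" "j < length xs" for i j
  proof -
    have "xs ! i \<in> I" "xs ! j \<in> I" "xs ! i \<noteq> xs ! j"
      using ij xs(1,2) by (auto simp: nth_eq_iff_index_eq)
    moreover have "(xs ! i, xs ! j) \<notin> crossing" using xs(3) ij by (simp add: sorted_wrt_iff_nth_less)
    ultimately show ?thesis using directed_arc(4) E by (simp add: crossing_def)
  qed
  then show ?thesis using xs(1,2) by (auto simp: sorted_wrt_iff_nth_less)
qed

text \<open>
  The path is \<open>a 0\<close>, \<open>b 0\<close>, \<open>a 1\<close>, \<open>b 1\<close>, and so on. Its \<open>i\<close>-th edge joins \<open>b (i div 2)\<close> to
  \<open>a (Suc i div 2)\<close>, so both indices weakly increase along the path: two edges of it either share
  a vertex, and then cannot cross in a simple drawing, or are strictly ordered in both indices.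
  Since \<open>k\<close> is at least 2, the largest index \<open>k div 2\<close> is below \<open>k\<close>.
\<close>

lemma zigzag_plane_path:
  assumes k: "k \<ge> 2" and a: "inj_on a {..<k}" and b: "inj_on b {..<k}"
    and E: "\<And>i j. i < k \<Longrightarrow> j < k \<Longrightarrow> {b j, a i} \<in> E"
    and nocross: "\<And>i i' j j'. i < i' \<Longrightarrow> i' < k \<Longrightarrow> j < j' \<Longrightarrow> j' < k \<Longrightarrow>
      path_image (\<gamma> {b j, a i}) \<inter> path_image (\<gamma> {b j', a i'}) = {}"
  shows "plane_path V E \<gamma> k (map (\<lambda>i. if even i then a (i div 2) else b (i div 2)) [0..<Suc k])"
proof -
  define v where "v i = (if even i then a (i div 2) else b (i div 2))" for i
  have half: "i div 2 < k" if "i \<le> k" for i using that k by linarith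
  have ab: "a i \<noteq> b j" if "i < k" "j < k" for i j using edge_card[OF E[OF that]] by auto
  have parity: "v i \<noteq> v j" if "even i" "odd j" "i \<le> k" "j \<le> k" for i j
    using ab[OF half[OF that(3)] half[OF that(4)]] that by (simp add: v_def)
  have v_inj: "i = j" if ij: "v i = v j" "i \<le> k" "j \<le> k" for i j
  proof -
    have par: "even i = even j" using parity[of i j] parity[of j i] ij by auto
    then have "i div 2 = j div 2"
      using ij inj_onD[OF a, of "i div 2" "j div 2"] inj_onD[OF b, of "i div 2" "j div 2"]
        half[of i] half[of j] by (auto simp: v_def)
    then show "i = j" using par by presburger
  qed
  have inj: "inj_on v {0..<Suc k}" by (rule inj_onI, rule v_inj) auto
  have edge: "{v i, v (Suc i)} = {b (i div 2), a (Suc i div 2)}" for i by (auto simp: v_def)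
  have edgeE: "{v i, v (Suc i)} \<in> E" if "i < k" for i
    unfolding edge using that half[of i] half[of "Suc i"] by (intro E) auto
  have ne: "{v i, v (Suc i)} \<noteq> {v j, v (Suc j)}" if ij: "i < j" "j < k" for i j
  proof
    assume "{v i, v (Suc i)} = {v j, v (Suc j)}"
    then have "v i = v j \<or> v i = v (Suc j)" by blast
    then show False using v_inj[of i j] v_inj[of i "Suc j"] ij by auto
  qed
  have np: "\<not> arcs_cross (\<gamma> {v i, v (Suc i)}) (\<gamma> {v j, v (Suc j)}) \<and>
      \<not> arcs_cross (\<gamma> {v j, v (Suc j)}) (\<gamma> {v i, v (Suc i)})" if ij: "i < j" "j < k" for i j
  proof (cases "i div 2 = j div 2 \<or> Suc i div 2 = Suc j div 2")
    case True
    have E2: "{v i, v (Suc i)} \<in> E" "{v j, v (Suc j)} \<in> E" using edgeE ij by auto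
    from True have "\<exists>w. w \<in> {v i, v (Suc i)} \<and> w \<in> {v j, v (Suc j)}" unfolding edge by auto
    then obtain w where "w \<in> {v i, v (Suc i)}" "w \<in> {v j, v (Suc j)}" by blast
    then show ?thesis
      using adjacent_edges_dont_cross[OF E2 ne[OF ij]]
        adjacent_edges_dont_cross[OF E2(2,1) ne[OF ij, symmetric]] by blast
  next
    case False
    then have "i div 2 < j div 2" "Suc i div 2 < Suc j div 2"
      using ij by (simp_all add: div_le_mono le_neq_implies_less)
    then have "path_image (\<gamma> {v i, v (Suc i)}) \<inter> path_image (\<gamma> {v j, v (Suc j)}) = {}"
      unfolding edge using ij half[of j] half[of "Suc j"] by (intro nocross) auto
    then show ?thesis
      using disjoint_images_dont_cross by (metis Int_commute)
  qed
  have nth: "map v [0..<Suc k] ! i = v i" if "i \<le> k" for i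
    using that by (simp del: upt_Suc)
  have "graph_path V E k (map v [0..<Suc k])"
    unfolding graph_path_def
  proof (intro conjI allI impI)
    show "distinct (map v [0..<Suc k])" using inj by (simp add: distinct_map del: upt_Suc)
    have "v i \<in> V" if "i \<le> k" for i
    proof (cases "i < k")
      case True
      then show ?thesis using edge_subset[OF edgeE[of i]] by blast
    next
      case False
      then have "Suc (k - 1) = i" using that k by simp
      then show ?thesis using edge_subset[OF edgeE[of "k - 1"]] k by auto
    qed
    then show "set (map v [0..<Suc k]) \<subseteq> V" by (auto simp del: upt_Suc)
    show "{map v [0..<Suc k] ! i, map v [0..<Suc k] ! Suc i} \<in> E" if "i < k" for i
      using edgeE[OF that] that nth by (simp del: upt_Suc)
  qed (simp del: upt_Suc)
  moreover have "\<not> arcs_cross (\<gamma> {map v [0..<Suc k] ! i, map v [0..<Suc k] ! Suc i})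
      (\<gamma> {map v [0..<Suc k] ! j, map v [0..<Suc k] ! Suc j})" if "i < k" "j < k" "i \<noteq> j" for i j
    using that np[of i j] np[of j i] nth by (cases "i < j") (auto simp del: upt_Suc)
  ultimately show ?thesis unfolding plane_path_def v_def by blast
qed

lemma no_edges_if_no_path_of_length_1:
  assumes "\<not> (\<exists>vs. plane_path V E \<gamma> 1 vs)"
  shows "E = {}"
proof (rule ccontr)
  assume "E \<noteq> {}"
  then obtain e where e: "e \<in> E" by blast
  then obtain u v where "e = {u, v}" "u \<noteq> v" using edge_card card_2_iff by metis
  then have "plane_path V E \<gamma> 1 [u, v]"
    using e edge_subset[OF e] by (auto simp: plane_path_def graph_path_def)
  then show False using assms by blast
qed

end

text \<open>
  Colour each pair of vertices of the large side by an ordering of the small side without forward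
  crossings. There are finitely many orderings, depending on \<open>k\<close> only, so Ramsey's theorem yields
  \<open>k\<close> vertices of the large side for which one ordering serves all pairs.
\<close>

lemma plane_path_in_complete_bipartite:
  fixes k :: nat
  assumes k: "k \<ge> 2"
  obtains N :: nat where "\<And>V E \<gamma> A B. \<lbrakk>simple_topological_graph V E \<gamma>; card A = k; card B = N;
    \<forall>x\<in>A. \<forall>y\<in>B. {x, y} \<in> E\<rbrakk> \<Longrightarrow> \<exists>vs. plane_path V E \<gamma> k vs"
proof -
  have "{xs. distinct xs \<and> set xs = {..<k}} \<subseteq> {xs. set xs \<subseteq> {..<k} \<and> length xs = k}"
    using distinct_card[where 'a = nat] by force
  then have "finite {xs. distinct xs \<and> set xs = {..<k}}"
    by (rule finite_subset) (simp add: finite_lists_length_eq)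
  from ramsey_ordered_pairs[OF this, of k] obtain N :: nat where
    N: "\<And>c. (\<And>i j. i < j \<Longrightarrow> j < N \<Longrightarrow> c i j \<in> {xs. distinct xs \<and> set xs = {..<k}}) \<Longrightarrow>
    \<exists>H col. H \<subseteq> {..<N} \<and> card H = k \<and> col \<in> {xs. distinct xs \<and> set xs = {..<k}} \<and>
      (\<forall>i\<in>H. \<forall>j\<in>H. i < j \<longrightarrow> c i j = col)" by blast
  show ?thesis
  proof (rule that[of N])
    fix V E \<gamma> A B
    assume G: "simple_topological_graph V E \<gamma>" and A: "card A = k" and B: "card B = N"
      and E: "\<forall>x\<in>A. \<forall>y\<in>B. {x, y} \<in> E"
    have "finite A" using A k card.infinite by fastforce
    then obtain \<alpha> where \<alpha>: "bij_betw \<alpha> {..<k} A"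
      using ex_bij_betw_nat_finite A by (metis atLeast0LessThan)
    have "\<exists>\<beta>. inj_on \<beta> {..<N} \<and> \<beta> ` {..<N} \<subseteq> B"
    proof (cases "N = 0")
      case False
      then have "finite B" using B card.infinite by fastforce
      then show ?thesis using ex_bij_betw_nat_finite B unfolding bij_betw_def
        by (metis atLeast0LessThan order_refl)
    qed auto
    then obtain \<beta> where \<beta>: "inj_on \<beta> {..<N}" "\<beta> ` {..<N} \<subseteq> B" by blast
    have E': "{\<beta> j, \<alpha> i} \<in> E" if "i < k" "j < N" for i j
    proof -
      have "\<alpha> i \<in> A" "\<beta> j \<in> B" using that \<alpha> \<beta> by (auto simp: bij_betw_def)
      then show ?thesis using E by (metis insert_commute)
    qed
    define good where "good i j xs \<longleftrightarrow> distinct xs \<and> set xs = {..<k} \<and>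
      sorted_wrt (\<lambda>p q. path_image (\<gamma> {\<beta> i, \<alpha> p}) \<inter> path_image (\<gamma> {\<beta> j, \<alpha> q}) = {}) xs" for i j xs
    have "\<exists>xs. good i j xs" if ij: "i < j" "j < N" for i j
      unfolding good_def
    proof (rule ordering_without_forward_crossings[OF G])
      show "\<beta> i \<noteq> \<beta> j" using \<beta>(1) ij by (auto dest: inj_onD)
    qed (use \<alpha> E' ij in \<open>auto simp: bij_betw_def\<close>)
    then obtain c where c: "\<And>i j. i < j \<Longrightarrow> j < N \<Longrightarrow> good i j (c i j)" by metis
    obtain H xs where H: "H \<subseteq> {..<N}" "card H = k" and xs: "distinct xs" "set xs = {..<k}"
      and col: "\<forall>i\<in>H. \<forall>j\<in>H. i < j \<longrightarrow> c i j = xs"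
      using N[of c] c by (auto simp: good_def)
    have "finite H" using H(1) finite_subset by blast
    then obtain h where h: "bij_betw h {..<k} H" "strict_mono_on {..<k} h"
      using ex_bij_betw_strict_mono_card[of H] H(2) by metis
    have len: "length xs = k" using distinct_card[OF xs(1)] xs(2) by simp
    have hH: "h j \<in> H" "h j < N" if "j < k" for j using h(1) H(1) that by (auto simp: bij_betw_def)
    have xsk: "xs ! i < k" if "i < k" for i using that xs(2) len nth_mem by fastforce
    have "plane_path V E \<gamma> k
        (map (\<lambda>i. if even i then (\<lambda>i. \<alpha> (xs ! i)) (i div 2) else (\<lambda>j. \<beta> (h j)) (i div 2)) [0..<Suc k])"
    proof (rule zigzag_plane_path[OF G k])
      show "inj_on (\<lambda>i. \<alpha> (xs ! i)) {..<k}"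
      proof (rule inj_onI)
        fix i i' assume i: "i \<in> {..<k}" "i' \<in> {..<k}" "\<alpha> (xs ! i) = \<alpha> (xs ! i')"
        then have "xs ! i = xs ! i'"
          using inj_onD[OF bij_betw_imp_inj_on[OF \<alpha>] i(3)] xsk by simp
        then show "i = i'" using i xs(1) len by (simp add: nth_eq_iff_index_eq)
      qed
      show "inj_on (\<lambda>j. \<beta> (h j)) {..<k}"
      proof (rule inj_onI)
        fix j j' assume j: "j \<in> {..<k}" "j' \<in> {..<k}" "\<beta> (h j) = \<beta> (h j')"
        then have "h j = h j'" using inj_onD[OF \<beta>(1) j(3)] hH by simp
        then show "j = j'" using inj_onD[OF bij_betw_imp_inj_on[OF h(1)]] j by blast
      qed
      show "{\<beta> (h j), \<alpha> (xs ! i)} \<in> E" if "i < k" "j < k" for i j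
        using E' xsk hH that by blast
      fix i i' j j' assume ij: "i < i'" "i' < k" "j < j'" "j' < k"
      have hj: "h j < h j'" using h(2) ij by (auto simp: strict_mono_on_def)
      have "c (h j) (h j') = xs" using col hH hj ij by auto
      then have "good (h j) (h j') xs" using c[OF hj] hH ij by force
      then show "path_image (\<gamma> {\<beta> (h j), \<alpha> (xs ! i)}) \<inter> path_image (\<gamma> {\<beta> (h j'), \<alpha> (xs ! i')}) = {}"
        using ij len by (simp add: good_def sorted_wrt_iff_nth_less)
    qed
    then show "\<exists>vs. plane_path V E \<gamma> k vs" by blast
  qed
qed

theorem corollary1p4:
  "\<forall>k::nat. k > 0 \<longrightarrow>
     (\<exists>c::real. \<forall>n::nat. n > 0 \<longrightarrow>
        (\<forall>V E \<gamma>. simple_topological_graph V E \<gamma> \<and> card V = n \<and>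
            \<not> (\<exists>vs. plane_path V E \<gamma> k vs) \<longrightarrow>
            real (card E) \<le> c * real n powr (2 - 8 / real k ^ 4)))"
proof (intro allI impI)
  fix k :: nat assume "k > 0"
  then consider "k = 1" | "k \<ge> 2" by linarith
  then show "\<exists>c::real. \<forall>n::nat. n > 0 \<longrightarrow>
        (\<forall>V E \<gamma>. simple_topological_graph V E \<gamma> \<and> card V = n \<and>
            \<not> (\<exists>vs. plane_path V E \<gamma> k vs) \<longrightarrow>
            real (card E) \<le> c * real n powr (2 - 8 / real k ^ 4))"
  proof cases
    case 1
    have "card E = 0"
      if "simple_topological_graph V E \<gamma>" "\<not> (\<exists>vs. plane_path V E \<gamma> k vs)" for V E \<gamma>
    proof -
      have "E = {}" using no_edges_if_no_path_of_length_1[OF that(1)] that(2) 1 by blast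
      then show ?thesis by simp
    qed
    then show ?thesis by (intro exI[of _ 0] allI impI) (elim conjE, simp)
  next
    case 2
    obtain N where N: "\<And>V E \<gamma> A B. \<lbrakk>simple_topological_graph V E \<gamma>; card A = k; card B = N;
        \<forall>x\<in>A. \<forall>y\<in>B. {x, y} \<in> E\<rbrakk> \<Longrightarrow> \<exists>vs. plane_path V E \<gamma> k vs"
      using plane_path_in_complete_bipartite[OF 2] by blast
    \<comment> \<open>Equivalent to \<open>8 \<le> k ^ 3\<close>, which is where \<open>k \<ge> 2\<close> enters.\<close>
    have "8 / real k ^ 4 \<le> 1 / real k"
    proof -
      have "(2::real) ^ 3 \<le> real k ^ 3" using 2 by (intro power_mono) auto
      then have "8 * real k \<le> real k ^ 3 * real k" by (intro mult_right_mono) auto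
      then show ?thesis using 2 by (simp add: field_simps power4_eq_xxxx power3_eq_cube)
    qed
    then have exponent: "2 - 1 / real k \<le> 2 - 8 / real k ^ 4" by simp
    show ?thesis
    proof (intro exI[of _ "real ((N + 1) * k)"] allI impI)
      fix n V E \<gamma>
      assume n: "(n::nat) > 0" and "simple_topological_graph V E \<gamma> \<and> card V = n \<and>
            \<not> (\<exists>vs. plane_path V E \<gamma> k vs)"
      then have G: "simple_topological_graph V E \<gamma>" and V: "card V = n"
        and no: "\<not> (\<exists>vs. plane_path V E \<gamma> k vs)" by auto
      have "finite V" using V n card.infinite by fastforce
      moreover have "e \<subseteq> V \<and> card e = 2" if "e \<in> E" for e
        using edge_subset[OF G that] edge_card[OF G that] by blast
      moreover have "\<not> (\<exists>A B. A \<subseteq> V \<and> B \<subseteq> V \<and> card A = k \<and> card B = N \<and> (\<forall>x\<in>A. \<forall>y\<in>B. {x, y} \<in> E))"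
        using N[OF G] no by blast
      ultimately have "real (card E) \<le> real ((N + 1) * k) * real n powr (2 - 1 / real k)"
        using kovari_sos_turan[of V E k N] 2 V by simp
      also have "\<dots> \<le> real ((N + 1) * k) * real n powr (2 - 8 / real k ^ 4)"
        using n by (intro mult_left_mono powr_mono exponent) auto
      finally show "real (card E) \<le> real ((N + 1) * k) * real n powr (2 - 8 / real k ^ 4)" .
    qed
  qed
qed

end
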